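(* Let $G=(V,E)$ be an infinite connected graph (directed or undirected) of bounded degree, let $\rho\in V$ be a fixed vertex, let $\nu$ be a probability distribution on $\mathbf{N}^*=\{1,2,\dots\}$, and let $R$ be a random variable distributed according to $\nu$. For $n\ge1$ and $t>0$ let $$\varphi(n)=\Delta\sum_{r=1}^{n}c_r\,c_r^\top,\qquad \psi_t(n)=\sum_{r=1}^{n}c_r^\top e^{t c_r}.$$ Assume $\mathbf{E}[\varphi(R)]<\infty$. If furthermore $\mathbf{E}[\psi_t(R)]<\infty$ for some $t>0$, then for all $p\in[0,1]$ with $p<\mathbf{E}[\varphi(R)]^{-1}$ there exists $\lambda>0$ such that for every $n\in\mathbf{N}$, $$\mathbf{P}(|W_\rho|>n)\le e^{-\lambda n}.$$ In particular, for $t>0$, $\mathbf{E}[\psi_t(R)]<\infty$ holds if $\mathbf{E}\big[e^{2t\Delta^R}\big]<\infty$.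
   Context: Graphs. $E\subset V\times V$; $G$ is undirected iff $(x,y)\in E\Leftrightarrow(y,x)\in E$ for all $x,y \in V$. For directed graphs, "connected" always means weakly connected, i.e. the underlying undirected graph is connected; connected components of subsets of $V$ are also taken in the underlying undirected graph. $G$ is infinite, connected and locally finite. For $x,y\in V$, $d(x,y)\in\mathbf{N}\cup\{+\infty\}$ is the minimal number of (oriented) edges of a path from $x$ to $y$ ($+\infty$ if there is none). For $x\in V$ and $r\in\mathbf{N}=\{0,1,2,\dots\}$, $B_r(x)=\{y\in V: d(x,y)<r\}$ and $B_r^\top(x)=\{y\in V: d(y,x)<r\}$. For $x\in V$, $d(x)$ is the number of vertices $y\neq x$ such that $(x,y)\in E$ or $(y,x)\in E$ (number of neighbours without regard to orientation), and $\Delta=\sup_{x\in V}d(x)$. $G$ is of bounded degree if $\Delta<\infty$. Set $c_r=\sup_{x\in V}|B_r(x)|$ and $c_r^\top=\sup_{x\in V}|B_r^\top(x)|$ (finite when $\Delta<\infty$). Boolean percolation model. Let $p\in[0,1]$. Let $(R_x)_{x\in V}$ be i.i.d. with law $\nu$, and let $(\sigma_x)_{x\in V}$ be i.i.d. Bernoulli of parameter $p$, independent of $(R_x)_{x\in V}$. The wet set is $W=\bigcup_{x\in V,\ \sigma_x=1}B_{R_x}(x)$. For $x\in V$, $W_x$ is the connected component of $x$ in $W$ (i.e. in the subgraph induced by $W$), with $W_x=\emptyset$ if $x\notin W$. *)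

theory Defs
  imports "HOL-Probability.Probability" "HOL-Library.Extended_Nat"
begin

text \<open>
  A graph is given by a vertex set V and a set E of oriented edges contained in V x V; it is
  undirected exactly when E is symmetric, so no separate treatment of the two cases is needed.
\<close>

text \<open>Since \<^const>\<open>card\<close> is 0 on infinite sets, cardinalities are taken in \<^typ>\<open>enat\<close>.\<close>

definition ecard :: "'a set \<Rightarrow> enat" where
  "ecard A = (if finite A then enat (card A) else \<infinity>)"

definition weakly_connected :: "'v set \<Rightarrow> ('v \<times> 'v) set \<Rightarrow> bool" where
  "weakly_connected V E \<longleftrightarrow> (\<forall>x\<in>V. \<forall>y\<in>V. (x, y) \<in> (E \<union> E\<inverse>)\<^sup>*)"

text \<open>The infimum of the empty set is \<open>\<infinity>\<close>, as required when there is no oriented path.\<close>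

definition gdist :: "('v \<times> 'v) set \<Rightarrow> 'v \<Rightarrow> 'v \<Rightarrow> enat" where
  "gdist E x y = (INF n\<in>{n. (x, y) \<in> E ^^ n}. enat n)"

definition out_ball :: "'v set \<Rightarrow> ('v \<times> 'v) set \<Rightarrow> nat \<Rightarrow> 'v \<Rightarrow> 'v set" where
  "out_ball V E r x = {y\<in>V. gdist E x y < enat r}"

definition in_ball :: "'v set \<Rightarrow> ('v \<times> 'v) set \<Rightarrow> nat \<Rightarrow> 'v \<Rightarrow> 'v set" where
  "in_ball V E r x = {y\<in>V. gdist E y x < enat r}"

definition vertex_degree :: "'v set \<Rightarrow> ('v \<times> 'v) set \<Rightarrow> 'v \<Rightarrow> enat" where
  "vertex_degree V E x = ecard {y\<in>V. y \<noteq> x \<and> ((x, y) \<in> E \<or> (y, x) \<in> E)}"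

definition max_degree :: "'v set \<Rightarrow> ('v \<times> 'v) set \<Rightarrow> enat" where
  "max_degree V E = (SUP x\<in>V. vertex_degree V E x)"

definition bounded_degree :: "'v set \<Rightarrow> ('v \<times> 'v) set \<Rightarrow> bool" where
  "bounded_degree V E \<longleftrightarrow> max_degree V E < \<infinity>"

definition max_out_ball :: "'v set \<Rightarrow> ('v \<times> 'v) set \<Rightarrow> nat \<Rightarrow> enat" where
  "max_out_ball V E r = (SUP x\<in>V. ecard (out_ball V E r x))"

definition max_in_ball :: "'v set \<Rightarrow> ('v \<times> 'v) set \<Rightarrow> nat \<Rightarrow> enat" where
  "max_in_ball V E r = (SUP x\<in>V. ecard (in_ball V E r x))"

text \<open>
  The following functions are only meaningful for graphs of bounded degree, where all the
  extended naturals passed to \<^const>\<open>the_enat\<close> are finite.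
\<close>

definition phi :: "'v set \<Rightarrow> ('v \<times> 'v) set \<Rightarrow> nat \<Rightarrow> real" where
  "phi V E n = real (the_enat (max_degree V E)) *
     (\<Sum>r=1..n. real (the_enat (max_out_ball V E r)) * real (the_enat (max_in_ball V E r)))"

definition psi :: "'v set \<Rightarrow> ('v \<times> 'v) set \<Rightarrow> real \<Rightarrow> nat \<Rightarrow> real" where
  "psi V E t n =
     (\<Sum>r=1..n. real (the_enat (max_in_ball V E r)) * exp (t * real (the_enat (max_out_ball V E r))))"

text \<open>
  The variables \<open>\<sigma> x\<close> take the values 0 and 1.  The last assumption is the independence of the
  two families as a whole, each viewed as one random variable in the product space.
\<close>

locale boolean_percolation = prob_space M
  for M :: "'w measure" and V :: "'v set" and \<nu> :: "nat pmf" and p :: real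
    and Rad \<sigma> :: "'v \<Rightarrow> 'w \<Rightarrow> nat" +
  assumes indep_Rad: "indep_vars (\<lambda>_. count_space UNIV) Rad V"
    and law_Rad: "x \<in> V \<Longrightarrow> distr M (count_space UNIV) (Rad x) = measure_pmf \<nu>"
    and indep_sigma: "indep_vars (\<lambda>_. count_space UNIV) \<sigma> V"
    and law_sigma: "x \<in> V \<Longrightarrow>
      distr M (count_space UNIV) (\<sigma> x) = measure_pmf (map_pmf of_bool (bernoulli_pmf p))"
    and indep_Rad_sigma:
      "indep_var (\<Pi>\<^sub>M x\<in>V. count_space UNIV) (\<lambda>\<omega>. \<lambda>x\<in>V. Rad x \<omega>)
                 (\<Pi>\<^sub>M x\<in>V. count_space UNIV) (\<lambda>\<omega>. \<lambda>x\<in>V. \<sigma> x \<omega>)"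

definition wet_set ::
    "'v set \<Rightarrow> ('v \<times> 'v) set \<Rightarrow> ('v \<Rightarrow> 'w \<Rightarrow> nat) \<Rightarrow> ('v \<Rightarrow> 'w \<Rightarrow> nat) \<Rightarrow> 'w \<Rightarrow> 'v set" where
  "wet_set V E Rad \<sigma> \<omega> = (\<Union>x\<in>{x\<in>V. \<sigma> x \<omega> = 1}. out_ball V E (Rad x \<omega>) x)"

definition component_in :: "('v \<times> 'v) set \<Rightarrow> 'v set \<Rightarrow> 'v \<Rightarrow> 'v set" where
  "component_in E W x = (if x \<in> W then {y\<in>W. (x, y) \<in> ((E \<union> E\<inverse>) \<inter> W \<times> W)\<^sup>*} else {})"

end

theory Submission
  imports Defs
begin

text \<open>
The cluster of \<open>\<rho>\<close> is explored ball by ball and compared with a subcritical branching process.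
Give a closed vertex the radius 0, so that the effective radii are i.i.d. with some law \<open>\<mu>\<close>, and
write \<open>c r\<close> and \<open>c' r\<close> for the maximal sizes of out-balls and in-balls of radius \<open>r\<close>.  The
cluster grows in generations: the first consists of the balls that contain \<open>\<rho>\<close>, and each further
one of the new balls that contain a neighbour of a vertex found before.  A ball of radius \<open>r\<close> has
at most \<open>\<Delta> * c r\<close> neighbouring vertices, and the mean number of balls of radius \<open>s\<close> through a given
vertex is at most \<open>p * \<nu> s * c' s\<close>.  Hence the mean offspring matrix has rank one, and its eigenvalue
\<open>p * \<Delta> * E (c R * c' R)\<close> is at most \<open>p * E (\<phi> R) < 1\<close>.

The comparison is an induction on the finite set \<open>F\<close> of vertices that may serve as centres
(\<open>exp_moment_explored\<close>).  It shows that the volume \<open>U\<close> found from a set \<open>A\<close> satisfies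
\<open>E (exp (\<theta> * U)) \<le> exp (K * card A)\<close> whenever \<open>E (c' X * (exp ((\<theta> + \<Delta> * K) * c X) - 1)) \<le> K\<close> for an
effective radius \<open>X\<close>.  The centres whose balls have not been met are conditioned on this decreasing
event; Harris' inequality (\<open>nn_integral_Pi_pmf_antimono_product_le\<close>) removes the conditioning.  To
first order in the exponents, the condition on \<open>\<theta>\<close> and \<open>K\<close> says that the eigenvalue is less than 1,
and the moment assumption on \<open>\<psi>\<close> justifies the expansion (\<open>exists_subcritical_exponent\<close>).

Markov's inequality and an exhaustion of \<open>V\<close> by finite sets give \<open>P (card W > n) \<le> exp (K - \<theta> * n)\<close>.
The constant \<open>exp K\<close> disappears after lowering the rate, because \<open>\<rho>\<close> is wet with probability at most
\<open>p * E (c' R) < 1\<close> (\<open>exists_exponential_rate\<close>).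
\<close>

section \<open>Inequalities for products of discrete laws\<close>

lemma nn_integral_pmf_times:
  fixes f :: "'a \<Rightarrow> ennreal" and g :: "'b \<Rightarrow> ennreal"
  shows "(\<integral>\<^sup>+r. \<integral>\<^sup>+s. f r * g s \<partial>measure_pmf q \<partial>measure_pmf p)
    = (\<integral>\<^sup>+r. f r \<partial>measure_pmf p) * (\<integral>\<^sup>+s. g s \<partial>measure_pmf q)"
  by (simp add: nn_integral_cmult nn_integral_multc)

text \<open>
For an increasing function and a decreasing event of one variable, the correlation is
nonpositive: compare \<open>g r\<close> with \<open>g s\<close> for independent \<open>r \<in> D\<close> and \<open>s \<notin> D\<close>, where
necessarily \<open>r \<le> s\<close>.
\<close>

lemma nn_integral_antimono_indicator_le:
  fixes g :: "nat \<Rightarrow> ennreal" and \<mu> :: "nat pmf"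
  assumes g: "mono g" and D: "\<And>r s. r \<le> s \<Longrightarrow> s \<in> D \<Longrightarrow> r \<in> D"
  shows "(\<integral>\<^sup>+r. indicator D r * g r \<partial>\<mu>) \<le> (\<integral>\<^sup>+r. indicator D r \<partial>\<mu>) * (\<integral>\<^sup>+r. g r \<partial>\<mu>)"
proof -
  let ?C = "- D"
  have le: "(indicator D r * g r) * indicator ?C s \<le> indicator D r * (indicator ?C s * g s)" for r s
  proof (cases "r \<in> D \<and> s \<notin> D")
    case True
    then have "r \<le> s" using D[of s r] by (metis nat_le_linear)
    then have "g r \<le> g s" using g by (rule monoD[rotated])
    then show ?thesis using True by (simp add: indicator_def)
  qed (auto simp: indicator_def)
  have one: "(\<integral>\<^sup>+r. indicator D r \<partial>\<mu>) + (\<integral>\<^sup>+r. indicator ?C r \<partial>\<mu>) = 1"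
  proof -
    have "(\<integral>\<^sup>+r. indicator D r \<partial>\<mu>) + (\<integral>\<^sup>+r. indicator ?C r \<partial>\<mu>)
        = (\<integral>\<^sup>+r. indicator D r + indicator ?C r \<partial>\<mu>)"
      by (rule nn_integral_add[symmetric]) auto
    also have "\<dots> = (\<integral>\<^sup>+r. 1 \<partial>\<mu>)" by (intro nn_integral_cong) (auto simp: indicator_def)
    finally show ?thesis by simp
  qed
  have "(\<integral>\<^sup>+r. indicator D r * g r \<partial>\<mu>)
      = (\<integral>\<^sup>+r. indicator D r * g r \<partial>\<mu>) * (\<integral>\<^sup>+r. indicator D r \<partial>\<mu>)
      + (\<integral>\<^sup>+r. indicator D r * g r \<partial>\<mu>) * (\<integral>\<^sup>+s. indicator ?C s \<partial>\<mu>)"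
    by (subst distrib_left[symmetric]) (simp only: one mult_1_right)
  also have "(\<integral>\<^sup>+r. indicator D r * g r \<partial>\<mu>) * (\<integral>\<^sup>+s. indicator ?C s \<partial>\<mu>)
      = (\<integral>\<^sup>+r. \<integral>\<^sup>+s. (indicator D r * g r) * indicator ?C s \<partial>\<mu> \<partial>\<mu>)"
    by (rule nn_integral_pmf_times[symmetric])
  also have "\<dots> \<le> (\<integral>\<^sup>+r. \<integral>\<^sup>+s. indicator D r * (indicator ?C s * g s) \<partial>\<mu> \<partial>\<mu>)"
    by (intro nn_integral_mono le)
  also have "\<dots> = (\<integral>\<^sup>+r. indicator D r \<partial>\<mu>) * (\<integral>\<^sup>+s. indicator ?C s * g s \<partial>\<mu>)"
    by (rule nn_integral_pmf_times)
  also have "(\<integral>\<^sup>+r. indicator D r * g r \<partial>\<mu>) * (\<integral>\<^sup>+r. indicator D r \<partial>\<mu>)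
        + (\<integral>\<^sup>+r. indicator D r \<partial>\<mu>) * (\<integral>\<^sup>+s. indicator ?C s * g s \<partial>\<mu>)
      = (\<integral>\<^sup>+r. indicator D r \<partial>\<mu>) * ((\<integral>\<^sup>+r. indicator D r * g r \<partial>\<mu>) + (\<integral>\<^sup>+s. indicator ?C s * g s \<partial>\<mu>))"
    by (subst mult.commute) (rule distrib_left[symmetric])
  also have "(\<integral>\<^sup>+r. indicator D r * g r \<partial>\<mu>) + (\<integral>\<^sup>+s. indicator ?C s * g s \<partial>\<mu>)
      = (\<integral>\<^sup>+r. indicator D r * g r + indicator ?C r * g r \<partial>\<mu>)"
    by (rule nn_integral_add[symmetric]) auto
  also have "\<dots> = (\<integral>\<^sup>+r. g r \<partial>\<mu>)"
    by (intro nn_integral_cong) (auto simp: indicator_def)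
  finally show ?thesis by - (simp add: add_left_mono)
qed

lemma nn_integral_Pi_pmf_insert:
  assumes "finite F" "a \<notin> F"
  shows "(\<integral>\<^sup>+x. f x \<partial>Pi_pmf (insert a F) d p) = (\<integral>\<^sup>+r. \<integral>\<^sup>+x. f (x(a := r)) \<partial>Pi_pmf F d p \<partial>p a)"
  by (simp add: Pi_pmf_insert'[OF assms])

text \<open>
The case of Harris' inequality that is used below: conditioning i.i.d. variables on a product of
decreasing one-variable events does not raise the mean of an increasing function.
\<close>

lemma nn_integral_Pi_pmf_antimono_product_le:
  fixes H :: "('v \<Rightarrow> nat) \<Rightarrow> ennreal" and \<mu> :: "nat pmf"
  assumes F: "finite F" and H: "mono H" and D: "\<And>y r s. r \<le> s \<Longrightarrow> s \<in> D y \<Longrightarrow> r \<in> D y"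
  shows "(\<integral>\<^sup>+x. (\<Prod>y\<in>F. indicator (D y) (x y)) * H x \<partial>Pi_pmf F d (\<lambda>_. \<mu>))
    \<le> (\<Prod>y\<in>F. \<integral>\<^sup>+r. indicator (D y) r \<partial>\<mu>) * (\<integral>\<^sup>+x. H x \<partial>Pi_pmf F d (\<lambda>_. \<mu>))"
  using F H
proof (induction F arbitrary: H rule: finite_induct)
  case empty
  then show ?case by simp
next
  case (insert a F)
  let ?P = "Pi_pmf F d (\<lambda>_. \<mu>)" and ?Q = "\<Prod>y\<in>F. \<integral>\<^sup>+r. indicator (D y) r \<partial>\<mu>"
  have mono1: "mono (\<lambda>x. H (x(a := r)))" for r
    by (intro monoI monoD[OF insert.prems]) (auto simp: le_fun_def)
  have mono2: "mono (\<lambda>r. \<integral>\<^sup>+x. H (x(a := r)) \<partial>?P)"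
    by (rule monoI) (intro nn_integral_mono monoD[OF insert.prems], auto simp: le_fun_def)
  have "(\<integral>\<^sup>+x. (\<Prod>y\<in>insert a F. indicator (D y) (x y)) * H x \<partial>Pi_pmf (insert a F) d (\<lambda>_. \<mu>))
      = (\<integral>\<^sup>+r. \<integral>\<^sup>+x. (\<Prod>y\<in>insert a F. indicator (D y) ((x(a := r)) y)) * H (x(a := r)) \<partial>?P \<partial>\<mu>)"
    by (rule nn_integral_Pi_pmf_insert) fact+
  also have "\<dots> = (\<integral>\<^sup>+r. \<integral>\<^sup>+x. indicator (D a) r * ((\<Prod>y\<in>F. indicator (D y) (x y)) * H (x(a := r))) \<partial>?P \<partial>\<mu>)"
  proof (intro nn_integral_cong)
    fix r x
    have "(\<Prod>y\<in>F. indicator (D y) ((x(a := r)) y)) = (\<Prod>y\<in>F. indicator (D y) (x y) :: ennreal)"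
      using insert.hyps by (intro prod.cong) auto
    then show "(\<Prod>y\<in>insert a F. indicator (D y) ((x(a := r)) y)) * H (x(a := r))
      = indicator (D a) r * ((\<Prod>y\<in>F. indicator (D y) (x y)) * H (x(a := r)))"
      using insert.hyps by (simp add: mult.assoc)
  qed
  also have "\<dots> = (\<integral>\<^sup>+r. indicator (D a) r * \<integral>\<^sup>+x. (\<Prod>y\<in>F. indicator (D y) (x y)) * H (x(a := r)) \<partial>?P \<partial>\<mu>)"
    by (simp add: nn_integral_cmult)
  also have "\<dots> \<le> (\<integral>\<^sup>+r. indicator (D a) r * (?Q * \<integral>\<^sup>+x. H (x(a := r)) \<partial>?P) \<partial>\<mu>)"
    by (intro nn_integral_mono mult_left_mono insert.IH mono1) auto
  also have "\<dots> = ?Q * (\<integral>\<^sup>+r. indicator (D a) r * (\<integral>\<^sup>+x. H (x(a := r)) \<partial>?P) \<partial>\<mu>)"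
    by (subst nn_integral_cmult[symmetric]) (auto simp: mult_ac)
  also have "\<dots> \<le> ?Q * ((\<integral>\<^sup>+r. indicator (D a) r \<partial>\<mu>) * (\<integral>\<^sup>+r. \<integral>\<^sup>+x. H (x(a := r)) \<partial>?P \<partial>\<mu>))"
    by (rule mult_left_mono[OF nn_integral_antimono_indicator_le[OF mono2 D]]) auto
  also have "(\<integral>\<^sup>+r. \<integral>\<^sup>+x. H (x(a := r)) \<partial>?P \<partial>\<mu>) = (\<integral>\<^sup>+x. H x \<partial>Pi_pmf (insert a F) d (\<lambda>_. \<mu>))"
    by (rule nn_integral_Pi_pmf_insert[symmetric]) fact+
  finally show ?case using insert.hyps by (simp add: mult.left_commute mult.assoc)
qed

lemma prod_one_plus_le_exp:
  fixes a :: "'v \<Rightarrow> ennreal"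
  assumes F: "finite F" and k: "0 \<le> k" and le: "(\<Sum>y\<in>F. a y) \<le> ennreal k"
  shows "(\<Prod>y\<in>F. 1 + a y) \<le> ennreal (exp k)"
proof -
  have fin: "(\<Sum>y\<in>F. a y) < \<top>" using le ennreal_less_top[of k] by (rule le_less_trans)
  define b where "b y = enn2real (a y)" for y
  have ab: "a y = ennreal (b y)" if "y \<in> F" for y
    using fin F that unfolding b_def by (simp add: less_top)
  have b0: "b y \<ge> 0" for y by (simp add: b_def)
  have s: "(\<Sum>y\<in>F. a y) = ennreal (\<Sum>y\<in>F. b y)"
    using b0 ab by (simp add: sum_ennreal)
  have "(\<Prod>y\<in>F. 1 + a y) \<le> (\<Prod>y\<in>F. ennreal (exp (b y)))"
  proof (rule prod_mono_ennreal)
    fix y assume y: "y \<in> F"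
    have "1 + a y = ennreal (1 + b y)" using b0 ab[OF y] by (simp add: ennreal_plus)
    also have "\<dots> \<le> ennreal (exp (b y))" by (intro ennreal_leI) simp
    finally show "1 + a y \<le> ennreal (exp (b y))" .
  qed
  also have "\<dots> = ennreal (exp (\<Sum>y\<in>F. b y))"
    by (simp add: prod_ennreal exp_sum F)
  also have "\<dots> \<le> ennreal (exp k)"
    using le k unfolding s by (intro ennreal_leI) simp
  finally show ?thesis .
qed

section \<open>Exploration of a cluster\<close>

text \<open>
The deterministic setting of the exploration: \<open>B r y\<close> is the ball of radius \<open>r\<close> around \<open>y\<close> and
\<open>N v\<close> the set of neighbours of \<open>v\<close>.  The numbers \<open>c r\<close> and \<open>c' r\<close> bound the size of a ball of
radius \<open>r\<close> and the number of such balls through a given vertex.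
\<close>

locale ball_cover =
  fixes B :: "nat \<Rightarrow> 'v \<Rightarrow> 'v set" and N :: "'v \<Rightarrow> 'v set"
    and c c' :: "nat \<Rightarrow> nat" and \<Delta> :: nat
  assumes B_mono: "r \<le> s \<Longrightarrow> B r y \<subseteq> B s y"
    and finite_B: "finite (B r y)" and card_B: "card (B r y) \<le> c r"
    and finite_N: "finite (N v)" and card_N: "card (N v) \<le> \<Delta>"
    and finite_B': "finite {y. z \<in> B r y}" and card_B': "card {y. z \<in> B r y} \<le> c' r"
begin

text \<open>
The vertices found from the set \<open>A\<close> by using only the balls \<open>B (x y) y\<close> with centre \<open>y \<in> F\<close>: a ball
that contains a vertex of \<open>A\<close>, or a neighbour of a vertex found before, is found as a whole.  The
vertices of \<open>A\<close> themselves are found only if they are covered.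
\<close>

inductive_set explored :: "'v set \<Rightarrow> ('v \<Rightarrow> nat) \<Rightarrow> 'v set \<Rightarrow> 'v set"
  for F x A where
    seed: "\<lbrakk>y \<in> F; z \<in> A; z \<in> B (x y) y; v \<in> B (x y) y\<rbrakk> \<Longrightarrow> v \<in> explored F x A"
  | step: "\<lbrakk>u \<in> explored F x A; z \<in> N u; y \<in> F; z \<in> B (x y) y; v \<in> B (x y) y\<rbrakk>
      \<Longrightarrow> v \<in> explored F x A"

lemma explored_subset_balls: "explored F x A \<subseteq> (\<Union>y\<in>F. B (x y) y)"
  by (auto elim: explored.cases)

lemma finite_explored: "finite F \<Longrightarrow> finite (explored F x A)"
  by (rule finite_subset[OF explored_subset_balls]) (simp add: finite_B)

lemma explored_empty: "explored F x {} = {}"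
proof -
  have "v \<in> explored F x {} \<Longrightarrow> False" for v by (induction rule: explored.induct) auto
  then show ?thesis by blast
qed

lemma explored_mono:
  assumes "F \<subseteq> F'" "\<And>y. y \<in> F \<Longrightarrow> x y \<le> x' y"
  shows "explored F x A \<subseteq> explored F' x' A"
proof
  fix v assume "v \<in> explored F x A"
  then show "v \<in> explored F' x' A"
  proof induction
    case (seed y z v)
    then show ?case using assms B_mono[of "x y" "x' y" y] by (blast intro: explored.seed)
  next
    case (step u z y v)
    then show ?case using assms B_mono[of "x y" "x' y" y] by (blast intro: explored.step)
  qed
qed

lemma explored_cong:
  assumes "\<And>y. y \<in> F \<Longrightarrow> x y = x' y"
  shows "explored F x A = explored F x' A"
  using explored_mono[of F F x x' A] explored_mono[of F F x' x A] assms by fastforce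

text \<open>
All neighbours of the balls with centres in \<open>S\<close>, including those that lie inside these balls.
\<close>

definition boundary :: "'v set \<Rightarrow> ('v \<Rightarrow> nat) \<Rightarrow> 'v set" where
  "boundary S x = (\<Union>y\<in>S. \<Union>u\<in>B (x y) y. N u)"

lemma boundary_cong: "(\<And>y. y \<in> S \<Longrightarrow> x y = x' y) \<Longrightarrow> boundary S x = boundary S x'"
  by (auto simp: boundary_def)

lemma finite_boundary: "finite S \<Longrightarrow> finite (boundary S x)"
  by (simp add: boundary_def finite_B finite_N)

lemma card_boundary_le:
  assumes S: "finite S"
  shows "card (boundary S x) \<le> \<Delta> * (\<Sum>y\<in>S. c (x y))"
proof -
  have "card (boundary S x) \<le> (\<Sum>y\<in>S. card (\<Union>u\<in>B (x y) y. N u))"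
    unfolding boundary_def by (rule card_UN_le[OF S])
  also have "\<dots> \<le> (\<Sum>y\<in>S. \<Sum>u\<in>B (x y) y. card (N u))"
    by (intro sum_mono card_UN_le finite_B)
  also have "\<dots> \<le> (\<Sum>y\<in>S. \<Sum>u\<in>B (x y) y. \<Delta>)"
    by (intro sum_mono card_N)
  also have "\<dots> \<le> (\<Sum>y\<in>S. \<Delta> * c (x y))"
    by (intro sum_mono) (simp add: card_B)
  finally show ?thesis by (simp add: sum_distrib_left)
qed

text \<open>
The radii for which the ball around \<open>y\<close> meets \<open>A\<close>.
\<close>

definition hits :: "'v set \<Rightarrow> 'v \<Rightarrow> nat set" where
  "hits A y = {r. B r y \<inter> A \<noteq> {}}"

lemma hits_mono: "r \<le> s \<Longrightarrow> s \<in> - hits A y \<Longrightarrow> r \<in> - hits A y"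
  using B_mono[of r s y] by (auto simp: hits_def)

text \<open>
One generation of the exploration: after the balls that meet \<open>A\<close> have been found, everything else
is found from their boundary by balls with other centres.
\<close>

lemma explored_subset:
  assumes S: "S = {y\<in>F. x y \<in> hits A y}"
  shows "explored F x A \<subseteq> (\<Union>y\<in>S. B (x y) y) \<union> explored (F - S) x (boundary S x)"
proof
  fix v assume "v \<in> explored F x A"
  then show "v \<in> (\<Union>y\<in>S. B (x y) y) \<union> explored (F - S) x (boundary S x)"
  proof induction
    case (seed y z v)
    then show ?case by (auto simp: S hits_def)
  next
    case (step u z y v)
    show ?case
    proof (cases "y \<in> S")
      case True
      then show ?thesis using step by blast
    next
      case False
      with step have y: "y \<in> F - S" by blast
      from step.IH show ?thesis
      proof
        assume "u \<in> (\<Union>y\<in>S. B (x y) y)"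
        then have "z \<in> boundary S x" using step.hyps by (auto simp: boundary_def)
        then show ?thesis using y step.hyps by (blast intro: explored.seed)
      next
        assume "u \<in> explored (F - S) x (boundary S x)"
        then show ?thesis using y step.hyps by (blast intro: explored.step)
      qed
    qed
  qed
qed

lemma card_explored_le:
  assumes S: "S = {y\<in>F. x y \<in> hits A y}" and F: "finite F"
  shows "card (explored F x A) \<le> (\<Sum>y\<in>S. c (x y)) + card (explored (F - S) x (boundary S x))"
proof -
  have fS: "finite S" using F S by simp
  have "card (explored F x A) \<le> card ((\<Union>y\<in>S. B (x y) y) \<union> explored (F - S) x (boundary S x))"
    by (rule card_mono[OF _ explored_subset[OF S]]) (simp add: fS F finite_B finite_explored)
  also have "\<dots> \<le> card (\<Union>y\<in>S. B (x y) y) + card (explored (F - S) x (boundary S x))"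
    by (rule card_Un_le)
  also have "card (\<Union>y\<in>S. B (x y) y) \<le> (\<Sum>y\<in>S. card (B (x y) y))"
    by (rule card_UN_le[OF fS])
  also have "\<dots> \<le> (\<Sum>y\<in>S. c (x y))" by (intro sum_mono card_B)
  finally show ?thesis by simp
qed

text \<open>
Whatever the set of centres, at most \<open>c' r\<close> balls of radius \<open>r\<close> pass through each vertex of \<open>A\<close>.
\<close>

lemma sum_hits_le:
  assumes F: "finite F" and A: "finite A"
  shows "(\<Sum>y\<in>F. indicator (hits A y) r :: ennreal) \<le> of_nat (card A * c' r)"
proof -
  have "(\<Sum>y\<in>F. indicator (hits A y) r :: ennreal) = of_nat (card {y\<in>F. r \<in> hits A y})"
    using F by (simp add: indicator_def sum.If_cases of_nat_eq_iff Int_def)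
  also have "card {y\<in>F. r \<in> hits A y} \<le> card (\<Union>z\<in>A. {y. z \<in> B r y})"
    using A by (intro card_mono) (auto simp: hits_def finite_B')
  also have "\<dots> \<le> (\<Sum>z\<in>A. card {y. z \<in> B r y})" by (rule card_UN_le[OF A])
  also have "\<dots> \<le> (\<Sum>z\<in>A. c' r)" by (intro sum_mono card_B')
  finally show ?thesis by simp
qed

text \<open>
The exponential moment bound, by induction on the set \<open>F\<close> of available centres.  Let \<open>S\<close> be the set
of centres in \<open>F\<close> whose ball meets \<open>A\<close>.  The volume found is at most the volume of these balls plus
the volume that is found from their boundary with centres in \<open>F - S\<close>, and the radii of the latter
are conditioned on a product of decreasing events.  By Harris' inequality the conditioning can be
dropped, and the induction hypothesis bounds the remaining factor by \<open>exp (K * card boundary)\<close>.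
Summing over \<open>S\<close> gives a product over \<open>F\<close> of the factors \<open>1 + a y\<close>, where \<open>a y\<close> is the mean of
\<open>exp (\<kappa> * c r) - 1\<close> over the radii \<open>r\<close> for which the ball around \<open>y\<close> meets \<open>A\<close>, and
these means add up to at most \<open>K * card A\<close>.
\<close>

theorem exp_moment_explored:
  fixes \<mu> :: "nat pmf" and \<theta> K \<kappa> :: real
  assumes \<theta>: "\<theta> \<ge> 0" and K: "K \<ge> 0" and \<kappa>: "\<kappa> = \<theta> + real \<Delta> * K"
    and int: "(\<integral>\<^sup>+r. ennreal (real (c' r) * (exp (\<kappa> * c r) - 1)) \<partial>\<mu>) \<le> ennreal K"
    and F: "finite F" and A: "finite A"
  shows "(\<integral>\<^sup>+x. ennreal (exp (\<theta> * card (explored F x A))) \<partial>Pi_pmf F 0 (\<lambda>_. \<mu>))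
    \<le> ennreal (exp (K * card A))"
  using F A
proof (induction F arbitrary: A rule: finite_psubset_induct)
  case (psubset F)
  note finF = \<open>finite F\<close> and finA = \<open>finite A\<close>
  have \<kappa>0: "\<kappa> \<ge> 0" using \<theta> K \<kappa> by simp
  define H where "H F x A = ennreal (exp (\<theta> * card (explored F x A)))" for F A and x :: "'v \<Rightarrow> nat"
  define P where "P F = Pi_pmf F (0::nat) (\<lambda>_. \<mu>)" for F :: "'v set"
  define h where "h y r = (indicator (hits A y) r :: ennreal)" for y r
  define k where "k y r = (indicator (- hits A y) r :: ennreal)" for y r
  \<comment> \<open>The contribution of the event that \<open>S\<close> is the set of centres whose ball meets \<open>A\<close>.\<close>
  define G where "G S x = (\<Prod>y\<in>S. h y (x y) * ennreal (exp (\<theta> * c (x y))))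
     * ((\<Prod>y\<in>F - S. k y (x y)) * H (F - S) x (boundary S x))" for S and x :: "'v \<Rightarrow> nat"
  have H_mono: "mono (\<lambda>x. H S x A')" if "finite S" for S A'
  proof (intro monoI)
    fix x x' :: "'v \<Rightarrow> nat" assume "x \<le> x'"
    then have "explored S x A' \<subseteq> explored S x' A'" by (intro explored_mono) (auto simp: le_fun_def)
    then have "card (explored S x A') \<le> card (explored S x' A')"
      by (intro card_mono finite_explored that)
    then show "H S x A' \<le> H S x' A'"
      unfolding H_def using \<theta> by (intro ennreal_leI) (simp add: mult_left_mono)
  qed
  have pointwise: "H F x A \<le> (\<Sum>S\<in>Pow F. G S x)" for x
  proof -
    define S where "S = {y\<in>F. x y \<in> hits A y}"
    have S: "S \<subseteq> F" "finite S" using finF by (auto simp: S_def)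
    have "H F x A \<le> ennreal (exp (\<theta> * ((\<Sum>y\<in>S. c (x y)) + card (explored (F - S) x (boundary S x)))))"
      unfolding H_def using card_explored_le[OF S_def finF] \<theta>
      by (intro ennreal_leI) (simp add: mult_left_mono flip: of_nat_add of_nat_sum)
    also have "\<dots> = (\<Prod>y\<in>S. ennreal (exp (\<theta> * c (x y)))) * H (F - S) x (boundary S x)"
      by (simp add: H_def distrib_left exp_add sum_distrib_left exp_sum[OF S(2)] prod_ennreal prod_nonneg
          ennreal_mult)
    also have "\<dots> = G S x"
    proof -
      have "(\<Prod>y\<in>S. h y (x y) * ennreal (exp (\<theta> * c (x y)))) = (\<Prod>y\<in>S. ennreal (exp (\<theta> * c (x y))))"
        by (intro prod.cong) (auto simp: h_def S_def)
      moreover have "(\<Prod>y\<in>F - S. k y (x y)) = 1"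
        by (intro prod.neutral) (auto simp: k_def S_def)
      ultimately show ?thesis by (simp add: G_def)
    qed
    also have "\<dots> \<le> (\<Sum>S\<in>Pow F. G S x)"
      using S finF by (intro member_le_sum) auto
    finally show ?thesis .
  qed
  have G_int: "(\<integral>\<^sup>+x. G S x \<partial>P F) \<le> (\<Prod>y\<in>S. \<integral>\<^sup>+r. h y r * ennreal (exp (\<kappa> * c r)) \<partial>\<mu>)
      * (\<Prod>y\<in>F - S. \<integral>\<^sup>+r. k y r \<partial>\<mu>)" if S: "S \<subseteq> F" for S
  proof -
    have finS: "finite S" "finite (F - S)" using S finF by (auto dest: finite_subset)
    let ?m = "\<lambda>f g x. if x \<in> S then f x else g x"
    let ?q = "\<Prod>y\<in>F - S. \<integral>\<^sup>+r. k y r \<partial>\<mu>"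
    have "P F = map_pmf (\<lambda>(f, g). ?m f g) (pair_pmf (P S) (P (F - S)))"
      using Pi_pmf_union[OF finS, where dflt = 0 and p = "\<lambda>_. \<mu>"] S by (simp add: P_def Un_absorb1)
    then have "(\<integral>\<^sup>+x. G S x \<partial>P F) = (\<integral>\<^sup>+f. \<integral>\<^sup>+g. G S (?m f g) \<partial>P (F - S) \<partial>P S)"
      by (simp add: nn_integral_pair_pmf')
    also have "\<dots> \<le> (\<integral>\<^sup>+f. (\<Prod>y\<in>S. h y (f y) * ennreal (exp (\<kappa> * c (f y)))) * ?q \<partial>P S)"
    proof (rule nn_integral_mono)
      fix f
      let ?A = "boundary S f"
      let ?w = "\<Prod>y\<in>S. h y (f y) * ennreal (exp (\<theta> * c (f y)))"
      have Geq: "G S (?m f g) = ?w * ((\<Prod>y\<in>F - S. k y (g y)) * H (F - S) g ?A)" for g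
      proof -
        have "boundary S (?m f g) = ?A" by (rule boundary_cong) simp
        moreover have "explored (F - S) (?m f g) ?A = explored (F - S) g ?A"
          by (rule explored_cong) simp
        ultimately show ?thesis
          unfolding G_def H_def by (intro arg_cong2[where f = "(*)"] prod.cong) auto
      qed
      have rest: "(\<integral>\<^sup>+g. H (F - S) g ?A \<partial>P (F - S)) \<le> ennreal (exp (K * card ?A))"
      \<comment> \<open>If no ball meets \<open>A\<close>, the set of centres does not shrink, but then nothing is found.\<close>
      proof (cases "S = {}")
        case True
        then show ?thesis by (simp add: H_def boundary_def explored_empty)
      next
        case False
        then show ?thesis unfolding H_def P_def
          using S finS by (intro psubset.IH finite_boundary) auto
      qed
      have "(\<integral>\<^sup>+g. G S (?m f g) \<partial>P (F - S))
          = ?w * (\<integral>\<^sup>+g. (\<Prod>y\<in>F - S. k y (g y)) * H (F - S) g ?A \<partial>P (F - S))"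
        by (simp add: Geq nn_integral_cmult)
      also have "\<dots> \<le> ?w * (?q * (\<integral>\<^sup>+g. H (F - S) g ?A \<partial>P (F - S)))"
        unfolding k_def P_def
        by (rule mult_left_mono[OF nn_integral_Pi_pmf_antimono_product_le[OF finS(2) H_mono[OF finS(2)] hits_mono]])
          auto
      also have "\<dots> \<le> ?w * (?q * ennreal (exp (K * card ?A)))"
        by (intro mult_left_mono rest) auto
      also have "\<dots> \<le> ?w * (?q * (\<Prod>y\<in>S. ennreal (exp (real \<Delta> * K * c (f y)))))"
      proof -
        have "K * card ?A \<le> K * (real \<Delta> * (\<Sum>y\<in>S. c (f y)))"
          using card_boundary_le[OF finS(1), of f] K
          by (intro mult_left_mono) (simp_all flip: of_nat_sum of_nat_mult)
        then have "ennreal (exp (K * card ?A)) \<le> (\<Prod>y\<in>S. ennreal (exp (real \<Delta> * K * c (f y))))"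
          by (simp add: prod_ennreal exp_sum[OF finS(1), symmetric] ennreal_leI sum_distrib_left mult_ac)
        then show ?thesis by (intro mult_left_mono) auto
      qed
      also have "\<dots> = (\<Prod>y\<in>S. h y (f y) * ennreal (exp (\<theta> * c (f y))) * ennreal (exp (real \<Delta> * K * c (f y)))) * ?q"
        by (simp add: prod.distrib mult_ac)
      also have "\<dots> = (\<Prod>y\<in>S. h y (f y) * ennreal (exp (\<kappa> * c (f y)))) * ?q"
        by (simp add: \<kappa> mult.assoc distrib_right exp_add ennreal_mult)
      finally show "(\<integral>\<^sup>+g. G S (?m f g) \<partial>P (F - S))
        \<le> (\<Prod>y\<in>S. h y (f y) * ennreal (exp (\<kappa> * c (f y)))) * ?q" .
    qed
    also have "\<dots> = (\<integral>\<^sup>+f. (\<Prod>y\<in>S. h y (f y) * ennreal (exp (\<kappa> * c (f y)))) \<partial>P S) * ?q"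
      by (rule nn_integral_multc) simp
    also have "(\<integral>\<^sup>+f. (\<Prod>y\<in>S. h y (f y) * ennreal (exp (\<kappa> * c (f y)))) \<partial>P S)
        = (\<Prod>y\<in>S. \<integral>\<^sup>+r. h y r * ennreal (exp (\<kappa> * c r)) \<partial>\<mu>)"
      unfolding P_def by (rule nn_integral_prod_Pi_pmf[OF finS(1)])
    finally show ?thesis .
  qed
  define a where "a y = (\<integral>\<^sup>+r. h y r * ennreal (exp (\<kappa> * c r) - 1) \<partial>\<mu>)" for y
  have split: "(\<integral>\<^sup>+r. h y r * ennreal (exp (\<kappa> * c r)) \<partial>\<mu>) + (\<integral>\<^sup>+r. k y r \<partial>\<mu>) = 1 + a y" for y
  proof -
    have "(\<integral>\<^sup>+r. h y r * ennreal (exp (\<kappa> * c r)) \<partial>\<mu>) + (\<integral>\<^sup>+r. k y r \<partial>\<mu>)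
        = (\<integral>\<^sup>+r. h y r * ennreal (exp (\<kappa> * c r)) + k y r \<partial>\<mu>)"
      by (rule nn_integral_add[symmetric]) auto
    also have "\<dots> = (\<integral>\<^sup>+r. 1 + h y r * ennreal (exp (\<kappa> * c r) - 1) \<partial>\<mu>)"
    proof (intro nn_integral_cong)
      fix r
      have "ennreal (exp (\<kappa> * c r)) = 1 + ennreal (exp (\<kappa> * c r) - 1)"
        using \<kappa>0 by (subst ennreal_1[symmetric], subst ennreal_plus[symmetric]) auto
      then show "h y r * ennreal (exp (\<kappa> * c r)) + k y r = 1 + h y r * ennreal (exp (\<kappa> * c r) - 1)"
        by (simp add: h_def k_def indicator_def)
    qed
    also have "\<dots> = 1 + a y" by (simp add: nn_integral_add a_def)
    finally show ?thesis .
  qed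
  have sum_a: "(\<Sum>y\<in>F. a y) \<le> ennreal (K * card A)"
  proof -
    have "(\<Sum>y\<in>F. a y) = (\<integral>\<^sup>+r. (\<Sum>y\<in>F. h y r) * ennreal (exp (\<kappa> * c r) - 1) \<partial>\<mu>)"
      unfolding a_def by (subst nn_integral_sum[symmetric]) (auto simp: sum_distrib_right)
    also have "\<dots> \<le> (\<integral>\<^sup>+r. of_nat (card A * c' r) * ennreal (exp (\<kappa> * c r) - 1) \<partial>\<mu>)"
      unfolding h_def by (intro nn_integral_mono mult_right_mono sum_hits_le finF finA) auto
    also have "\<dots> = (\<integral>\<^sup>+r. ennreal (card A) * ennreal (real (c' r) * (exp (\<kappa> * c r) - 1)) \<partial>\<mu>)"
      using \<kappa>0 by (intro nn_integral_cong) (simp add: ennreal_mult ennreal_of_nat_eq_real_of_nat mult_ac)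
    also have "\<dots> = ennreal (card A) * (\<integral>\<^sup>+r. ennreal (real (c' r) * (exp (\<kappa> * c r) - 1)) \<partial>\<mu>)"
      by (rule nn_integral_cmult) simp
    also have "\<dots> \<le> ennreal (card A) * ennreal K" by (intro mult_left_mono int) auto
    finally show ?thesis using K by (simp add: ennreal_mult[symmetric] mult.commute)
  qed
  have "(\<integral>\<^sup>+x. H F x A \<partial>P F) \<le> (\<integral>\<^sup>+x. (\<Sum>S\<in>Pow F. G S x) \<partial>P F)"
    by (intro nn_integral_mono pointwise)
  also have "\<dots> = (\<Sum>S\<in>Pow F. \<integral>\<^sup>+x. G S x \<partial>P F)" by (rule nn_integral_sum) simp
  also have "\<dots> \<le> (\<Sum>S\<in>Pow F. (\<Prod>y\<in>S. \<integral>\<^sup>+r. h y r * ennreal (exp (\<kappa> * c r)) \<partial>\<mu>)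
      * (\<Prod>y\<in>F - S. \<integral>\<^sup>+r. k y r \<partial>\<mu>))"
    by (intro sum_mono G_int) auto
  also have "\<dots> = (\<Prod>y\<in>F. (\<integral>\<^sup>+r. h y r * ennreal (exp (\<kappa> * c r)) \<partial>\<mu>) + (\<integral>\<^sup>+r. k y r \<partial>\<mu>))"
    by (rule prod_add[OF finF, symmetric])
  also have "\<dots> = (\<Prod>y\<in>F. 1 + a y)" by (simp only: split)
  also have "\<dots> \<le> ennreal (exp (K * card A))"
    by (rule prod_one_plus_le_exp[OF finF _ sum_a]) (use K in simp)
  finally show ?case by (simp add: H_def P_def)
qed

end

context ball_cover begin

text \<open>
The first moment bound on the probability that \<open>z\<close> is covered.
\<close>

lemma prob_explored_nonempty:
  fixes \<mu> :: "nat pmf"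
  assumes F: "finite F"
  shows "emeasure (Pi_pmf F 0 (\<lambda>_. \<mu>)) {x. explored F x {z} \<noteq> {}} \<le> (\<integral>\<^sup>+r. of_nat (c' r) \<partial>\<mu>)"
proof -
  let ?P = "Pi_pmf F 0 (\<lambda>_. \<mu>)"
  have pw: "indicator {x. explored F x {z} \<noteq> {}} x \<le> (\<Sum>y\<in>F. indicator (hits {z} y) (x y) :: ennreal)" for x
  proof (cases "explored F x {z} \<noteq> {}")
    case True
    have "v \<in> explored F x {z} \<Longrightarrow> \<exists>y\<in>F. x y \<in> hits {z} y" for v
      by (induction rule: explored.induct) (auto simp: hits_def)
    then obtain y where y: "y \<in> F" "x y \<in> hits {z} y" using True by blast
    have "(indicator (hits {z} y) (x y) :: ennreal) \<le> (\<Sum>y\<in>F. indicator (hits {z} y) (x y))"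
      using y F by (intro member_le_sum) auto
    then show ?thesis using True y by simp
  qed simp
  have marg: "(\<integral>\<^sup>+x. f (x y) \<partial>?P) = (\<integral>\<^sup>+r. f r \<partial>\<mu>)" if "y \<in> F" for f :: "nat \<Rightarrow> ennreal" and y
  proof -
    have "(\<integral>\<^sup>+x. f (x y) \<partial>?P) = (\<integral>\<^sup>+r. f r \<partial>map_pmf (\<lambda>x. x y) ?P)" by simp
    then show ?thesis using Pi_pmf_component[OF F, of y 0 "\<lambda>_. \<mu>"] that by simp
  qed
  have "emeasure ?P {x. explored F x {z} \<noteq> {}} = (\<integral>\<^sup>+x. indicator {x. explored F x {z} \<noteq> {}} x \<partial>?P)"
    by simp
  also have "\<dots> \<le> (\<integral>\<^sup>+x. (\<Sum>y\<in>F. indicator (hits {z} y) (x y)) \<partial>?P)"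
    by (intro nn_integral_mono pw)
  also have "\<dots> = (\<Sum>y\<in>F. \<integral>\<^sup>+r. indicator (hits {z} y) r \<partial>\<mu>)"
    by (subst nn_integral_sum) (auto intro!: sum.cong marg simp del: nn_integral_indicator)
  also have "\<dots> = (\<integral>\<^sup>+r. (\<Sum>y\<in>F. indicator (hits {z} y) r) \<partial>\<mu>)"
    by (rule nn_integral_sum[symmetric]) simp
  also have "\<dots> \<le> (\<integral>\<^sup>+r. of_nat (c' r) \<partial>\<mu>)"
    using sum_hits_le[OF F, of "{z}"] by (intro nn_integral_mono) simp
  finally show ?thesis .
qed

lemma prob_card_explored_gt:
  fixes \<mu> :: "nat pmf" and \<theta> K \<kappa> :: real
  assumes \<theta>: "\<theta> \<ge> 0" and K: "K \<ge> 0" and \<kappa>: "\<kappa> = \<theta> + real \<Delta> * K"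
    and int: "(\<integral>\<^sup>+r. ennreal (real (c' r) * (exp (\<kappa> * c r) - 1)) \<partial>\<mu>) \<le> ennreal K"
    and F: "finite F"
  shows "emeasure (Pi_pmf F 0 (\<lambda>_. \<mu>)) {x. n < card (explored F x {z})} \<le> ennreal (exp (K - \<theta> * n))"
proof -
  let ?P = "Pi_pmf F 0 (\<lambda>_. \<mu>)"
  have pw: "indicator {x. n < card (explored F x {z})} x
      \<le> ennreal (exp (- \<theta> * n)) * ennreal (exp (\<theta> * card (explored F x {z})))" for x
  proof (cases "n < card (explored F x {z})")
    case True
    then have "1 \<le> exp (- \<theta> * n) * exp (\<theta> * card (explored F x {z}))"
      using \<theta> by (simp add: mult_left_mono flip: exp_add)
    then show ?thesis using True
      by (simp add: ennreal_mult[symmetric] del: ennreal_1 flip: ennreal_1)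
  qed simp
  have "emeasure ?P {x. n < card (explored F x {z})} = (\<integral>\<^sup>+x. indicator {x. n < card (explored F x {z})} x \<partial>?P)"
    by simp
  also have "\<dots> \<le> (\<integral>\<^sup>+x. ennreal (exp (- \<theta> * n)) * ennreal (exp (\<theta> * card (explored F x {z}))) \<partial>?P)"
    by (intro nn_integral_mono pw)
  also have "\<dots> = ennreal (exp (- \<theta> * n)) * (\<integral>\<^sup>+x. ennreal (exp (\<theta> * card (explored F x {z}))) \<partial>?P)"
    by (rule nn_integral_cmult) simp
  also have "\<dots> \<le> ennreal (exp (- \<theta> * n)) * ennreal (exp (K * card {z}))"
    by (intro mult_left_mono exp_moment_explored[OF \<theta> K \<kappa> int F]) auto
  also have "\<dots> = ennreal (exp (K - \<theta> * n))"
    by (simp add: ennreal_mult[symmetric] flip: exp_add)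
  finally show ?thesis .
qed

text \<open>
Every vertex is found by a finite chain of balls, so finitely many vertices are already found with
the centres in one member of an exhausting sequence.
\<close>

lemma explored_finite_approx:
  fixes F :: "nat \<Rightarrow> 'v set"
  assumes F: "mono F" and D: "finite D" "D \<subseteq> explored (\<Union>k. F k) x A"
  shows "\<exists>k. D \<subseteq> explored (F k) x A"
proof -
  have mono: "explored (F j) x A \<subseteq> explored (F k) x A" if "j \<le> k" for j k
    using monoD[OF F that] by (intro explored_mono) auto
  have "v \<in> explored (\<Union>k. F k) x A \<Longrightarrow> \<exists>k. v \<in> explored (F k) x A" for v
  proof (induction rule: explored.induct)
    case (seed y z v)
    then show ?case by (blast intro: explored.seed)
  next
    case (step u z y v)
    then obtain i j where ij: "u \<in> explored (F i) x A" "y \<in> F j" by blast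
    have "u \<in> explored (F (max i j)) x A" using ij(1) mono[of i "max i j"] by auto
    moreover have "y \<in> F (max i j)" using ij(2) monoD[OF F, of j "max i j"] by auto
    ultimately show ?case using step by (blast intro: explored.step)
  qed
  then have "\<forall>v\<in>D. \<exists>k. v \<in> explored (F k) x A" using D(2) by blast
  then obtain k where k: "\<And>v. v \<in> D \<Longrightarrow> v \<in> explored (F (k v)) x A" by metis
  have "D \<subseteq> explored (F (Max (k ` D))) x A"
  proof
    fix v assume v: "v \<in> D"
    then have "k v \<le> Max (k ` D)" using D(1) by simp
    then show "v \<in> explored (F (Max (k ` D))) x A" using k[OF v] mono by blast
  qed
  then show ?thesis ..
qed

end

section \<open>Graphs of bounded degree\<close>

text \<open>
Neighbours without regard to orientation; loops are ignored, as they are in the degree.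
\<close>

definition neighbours :: "('v \<times> 'v) set \<Rightarrow> 'v \<Rightarrow> 'v set" where
  "neighbours E u = {z. z \<noteq> u \<and> ((u, z) \<in> E \<or> (z, u) \<in> E)}"

lemma gdist_less_iff: "gdist E x y < enat r \<longleftrightarrow> (\<exists>n<r. (x, y) \<in> E ^^ n)"
  unfolding gdist_def by (auto simp: INF_less_iff)

lemma relpow_mem_vertices:
  assumes "E \<subseteq> V \<times> V" "(x, y) \<in> E ^^ n"
  shows "x \<in> V \<longleftrightarrow> y \<in> V"
  using assms(2)
proof (induction n arbitrary: y)
  case (Suc n)
  then show ?case using assms(1) by (auto simp: relcomp_unfold)
qed simp

lemma mem_out_ball_iff:
  assumes "E \<subseteq> V \<times> V"
  shows "y \<in> out_ball V E r x \<longleftrightarrow> x \<in> V \<and> (\<exists>n<r. (x, y) \<in> E ^^ n)"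
  using relpow_mem_vertices[OF assms] by (auto simp: out_ball_def gdist_less_iff)

lemma relpow_converse_iff:
  fixes E :: "('v \<times> 'v) set"
  shows "(x, y) \<in> (E\<inverse>) ^^ n \<longleftrightarrow> (y, x) \<in> E ^^ n"
proof (induction n arbitrary: y)
  case (Suc n)
  have "(x, y) \<in> (E\<inverse>) ^^ Suc n \<longleftrightarrow> (\<exists>z. (x, z) \<in> (E\<inverse>) ^^ n \<and> (y, z) \<in> E)"
    by auto
  also have "\<dots> \<longleftrightarrow> (y, x) \<in> E ^^ Suc n"
    using Suc.IH by (blast intro: relpow_Suc_I2 dest: relpow_Suc_D2)
  finally show ?case .
qed auto

lemma in_ball_converse: "in_ball V E r x = out_ball V (E\<inverse>) r x"
  by (simp add: in_ball_def out_ball_def gdist_less_iff relpow_converse_iff)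

lemma mem_in_ball_iff:
  assumes "E \<subseteq> V \<times> V"
  shows "y \<in> in_ball V E r x \<longleftrightarrow> x \<in> out_ball V E r y"
  using relpow_mem_vertices[OF assms]
  by (auto simp: in_ball_def out_ball_def gdist_less_iff)

lemma out_ball_0: "out_ball V E 0 x = {}"
  by (simp add: out_ball_def gdist_less_iff)

text \<open>
The recursion \<open>b (r + 1) \<le> 1 + D * b r\<close> for the sizes of balls gives \<open>b r + 1 \<le> D ^ r\<close>, since
\<open>2 \<le> D\<close>.
\<close>

lemma card_out_ball_le:
  assumes E: "E \<subseteq> V \<times> V" and D: "2 \<le> D"
    and N: "\<And>u. u \<in> V \<Longrightarrow> finite (neighbours E u) \<and> card (neighbours E u) \<le> D" and x: "x \<in> V"
  shows "finite (out_ball V E r x) \<and> card (out_ball V E r x) + 1 \<le> D ^ r"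
  using x
proof (induction r arbitrary: x)
  case 0
  then show ?case by (simp add: out_ball_0)
next
  case (Suc r)
  let ?U = "\<Union>z\<in>neighbours E x. out_ball V E r z"
  have NV: "neighbours E x \<subseteq> V" using E by (auto simp: neighbours_def)
  note IH = Suc.IH[OF subsetD[OF NV]]
  have step: "(x, y) \<in> E ^^ n \<Longrightarrow> n < Suc r \<Longrightarrow> y = x \<or> y \<in> ?U" for y n
  proof (induction n)
    case (Suc n)
    from Suc.prems obtain z where z: "(x, z) \<in> E" "(z, y) \<in> E ^^ n" by (blast dest: relpow_Suc_D2)
    show ?case
    \<comment> \<open>A loop at \<open>x\<close> does not count as a step to a neighbour.\<close>
    proof (cases "z = x")
      case True
      then show ?thesis using Suc z by simp
    next
      case False
      have "y \<in> out_ball V E r z"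
        unfolding mem_out_ball_iff[OF E] using z E Suc.prems by auto
      then show ?thesis using z False by (auto simp: neighbours_def)
    qed
  qed simp
  have sub: "out_ball V E (Suc r) x \<subseteq> insert x ?U"
  proof
    fix y assume "y \<in> out_ball V E (Suc r) x"
    then obtain n where "n < Suc r" "(x, y) \<in> E ^^ n" unfolding mem_out_ball_iff[OF E] by blast
    then show "y \<in> insert x ?U" using step by blast
  qed
  have fin: "finite ?U" using N[OF Suc.prems] IH by blast
  have "card (out_ball V E (Suc r) x) \<le> card (insert x ?U)"
    by (rule card_mono[OF _ sub]) (use fin in simp)
  also have "\<dots> \<le> Suc (card ?U)" using fin by (simp add: card_insert_if)
  also have "card ?U \<le> (\<Sum>z\<in>neighbours E x. card (out_ball V E r z))"
    using N[OF Suc.prems] by (intro card_UN_le) simp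
  also have "\<dots> \<le> (\<Sum>z\<in>neighbours E x. D ^ r - 1)"
  proof (rule sum_mono)
    fix z assume "z \<in> neighbours E x"
    from IH[OF this] show "card (out_ball V E r z) \<le> D ^ r - 1" by linarith
  qed
  also have "\<dots> \<le> D * (D ^ r - 1)" using N[OF Suc.prems] by simp
  finally have le: "card (out_ball V E (Suc r) x) \<le> Suc (D * (D ^ r - 1))" by simp
  have "1 \<le> D ^ r" using D by simp
  then have "D * (D ^ r - 1) + D = D ^ Suc r"
    by (simp add: right_diff_distrib')
  then have "Suc (D * (D ^ r - 1)) + 1 \<le> D ^ Suc r" using D by linarith
  then show ?case using le finite_subset[OF sub] fin by auto
qed

lemma ecard_le_enat_iff: "ecard A \<le> enat n \<longleftrightarrow> finite A \<and> card A \<le> n"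
  by (auto simp: ecard_def)

text \<open>
The graphs of the theorem.  The constants \<open>\<Delta>\<close>, \<open>c r\<close> and \<open>c' r\<close> are the maximal degree and the maximal
sizes of out-balls and in-balls as natural numbers.
\<close>

locale bounded_graph =
  fixes V :: "'v set" and E :: "('v \<times> 'v) set"
  assumes edges: "E \<subseteq> V \<times> V" and infinite_V: "infinite V"
    and conn: "weakly_connected V E" and bounded: "bounded_degree V E"
begin

definition "\<Delta> = the_enat (max_degree V E)"
definition "c r = the_enat (max_out_ball V E r)"
definition "c' r = the_enat (max_in_ball V E r)"

lemma neighbours_bound: "finite (neighbours E u) \<and> card (neighbours E u) \<le> \<Delta>"
proof (cases "u \<in> V")
  case True
  have "max_degree V E = enat \<Delta>"
    using bounded by (auto simp: \<Delta>_def bounded_degree_def)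
  then have "vertex_degree V E u \<le> enat \<Delta>"
    unfolding max_degree_def using True by (metis SUP_upper)
  moreover have "{y \<in> V. y \<noteq> u \<and> ((u, y) \<in> E \<or> (y, u) \<in> E)} = neighbours E u"
    using edges by (auto simp: neighbours_def)
  ultimately show ?thesis by (simp add: vertex_degree_def ecard_le_enat_iff)
next
  case False
  then have "neighbours E u = {}" using edges by (auto simp: neighbours_def)
  then show ?thesis by simp
qed

text \<open>
If all degrees are at most 1, then a vertex together with its neighbours is closed under adjacency,
so that a connected graph has at most two vertices.
\<close>

lemma degree_ge_2: "2 \<le> \<Delta>"
proof (rule ccontr)
  assume "\<not> 2 \<le> \<Delta>"
  then have le1: "card (neighbours E u) \<le> 1" for u using neighbours_bound[of u] by linarith
  obtain a where a: "a \<in> V" using infinite_V by fastforce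
  let ?S = "insert a (neighbours E a)"
  have uniq: "w = w'" if "w \<in> neighbours E u" "w' \<in> neighbours E u" for u w w'
    using le1[of u] neighbours_bound[of u] that by (metis card_le_Suc0_iff_eq One_nat_def)
  have "(a, y) \<in> (E \<union> E\<inverse>)\<^sup>* \<Longrightarrow> y \<in> ?S" for y
  proof (induction rule: rtrancl_induct)
    case (step y z)
    show ?case
    proof (cases "z = y")
      case False
      then have zy: "z \<in> neighbours E y" using step by (auto simp: neighbours_def)
      show ?thesis
      proof (cases "y = a")
        case False
        then have "a \<in> neighbours E y" using step by (auto simp: neighbours_def)
        then show ?thesis using uniq[OF zy] by auto
      qed (use zy in simp)
    qed (use step in simp)
  qed simp
  then have "V \<subseteq> ?S" using conn a by (auto simp: weakly_connected_def)
  then show False using infinite_V neighbours_bound[of a] finite_subset by blast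
qed

lemma card_out_ball_power: "finite (out_ball V E r x) \<and> card (out_ball V E r x) + 1 \<le> \<Delta> ^ r"
proof (cases "x \<in> V")
  case True
  then show ?thesis using card_out_ball_le[OF edges degree_ge_2] neighbours_bound by blast
next
  case False
  then have "out_ball V E r x = {}" by (auto simp: mem_out_ball_iff[OF edges])
  then show ?thesis using degree_ge_2 by simp
qed

text \<open>
In-balls are the out-balls of the reversed graph, which has the same degrees.
\<close>

lemma card_in_ball_power: "finite (in_ball V E r x) \<and> card (in_ball V E r x) + 1 \<le> \<Delta> ^ r"
proof -
  interpret rev: bounded_graph V "E\<inverse>"
  proof
    show "E\<inverse> \<subseteq> V \<times> V" using edges by blast
    show "weakly_connected V (E\<inverse>)" using conn by (simp add: weakly_connected_def Un_commute)
    show "bounded_degree V (E\<inverse>)"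
      using bounded by (simp add: bounded_degree_def max_degree_def vertex_degree_def disj_commute)
  qed (rule infinite_V)
  have "rev.\<Delta> = \<Delta>"
    by (simp add: \<Delta>_def rev.\<Delta>_def max_degree_def vertex_degree_def disj_commute)
  then show ?thesis using rev.card_out_ball_power[of r x] by (simp add: in_ball_converse)
qed

lemma SUP_ecard_bounds:
  assumes "\<And>x. finite (S x) \<and> card (S x) + 1 \<le> b"
  shows "x \<in> V \<Longrightarrow> card (S x) \<le> the_enat (SUP x\<in>V. ecard (S x))"
    and "the_enat (SUP x\<in>V. ecard (S x)) + 1 \<le> b"
proof -
  have b: "1 \<le> b" using assms[of undefined] by simp
  have le: "(SUP x\<in>V. ecard (S x)) \<le> enat (b - 1)"
  proof (rule SUP_least)
    fix x
    show "ecard (S x) \<le> enat (b - 1)" using assms[of x] by (auto simp: ecard_le_enat_iff)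
  qed
  then obtain m where m: "(SUP x\<in>V. ecard (S x)) = enat m" "m \<le> b - 1"
    by (metis enat_ile enat_ord_simps(1))
  then show "the_enat (SUP x\<in>V. ecard (S x)) + 1 \<le> b" using b by simp
  assume "x \<in> V"
  then have "ecard (S x) \<le> enat m" unfolding m(1)[symmetric] by (rule SUP_upper)
  then show "card (S x) \<le> the_enat (SUP x\<in>V. ecard (S x))" by (simp add: m ecard_le_enat_iff)
qed

lemma c_less_power: "c r + 1 \<le> \<Delta> ^ r"
  unfolding c_def max_out_ball_def by (rule SUP_ecard_bounds(2)[OF card_out_ball_power])

lemma c'_less_power: "c' r + 1 \<le> \<Delta> ^ r"
  unfolding c'_def max_in_ball_def by (rule SUP_ecard_bounds(2)[OF card_in_ball_power])

lemma card_out_ball: "card (out_ball V E r x) \<le> c r"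
proof (cases "x \<in> V")
  case True
  then show ?thesis unfolding c_def max_out_ball_def by (rule SUP_ecard_bounds(1)[OF card_out_ball_power])
next
  case False
  then have "out_ball V E r x = {}" by (auto simp: mem_out_ball_iff[OF edges])
  then show ?thesis by simp
qed

lemma card_in_ball: "card (in_ball V E r x) \<le> c' r"
proof (cases "x \<in> V")
  case True
  then show ?thesis unfolding c'_def max_in_ball_def by (rule SUP_ecard_bounds(1)[OF card_in_ball_power])
next
  case False
  then have "in_ball V E r x = {}" by (auto simp: mem_in_ball_iff[OF edges] out_ball_def)
  then show ?thesis by simp
qed

lemma c'_0: "c' 0 = 0"
  using c'_less_power[of 0] by simp

lemma c_pos:
  assumes r: "1 \<le> r"
  shows "1 \<le> c r"
proof -
  obtain a where a: "a \<in> V" using infinite_V by fastforce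
  have "a \<in> out_ball V E r a"
    unfolding mem_out_ball_iff[OF edges] using a r by (intro conjI exI[of _ 0]) auto
  then have "card (out_ball V E r a) > 0" using card_out_ball_power[of r a] by (auto simp: card_gt_0_iff)
  then show ?thesis using card_out_ball[of r a] by linarith
qed

sublocale ball_cover "out_ball V E" "neighbours E" c c' \<Delta>
proof
  fix r s :: nat and y z v :: 'v
  show "r \<le> s \<Longrightarrow> out_ball V E r y \<subseteq> out_ball V E s y"
    using less_le_trans by (fastforce simp: mem_out_ball_iff[OF edges])
  show "finite (out_ball V E r y)" using card_out_ball_power by blast
  show "card (out_ball V E r y) \<le> c r" by (rule card_out_ball)
  show "finite (neighbours E v)" "card (neighbours E v) \<le> \<Delta>" using neighbours_bound by blast+
  have eq: "{y. z \<in> out_ball V E r y} = in_ball V E r z" by (auto simp: mem_in_ball_iff[OF edges])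
  show "finite {y. z \<in> out_ball V E r y}" unfolding eq using card_in_ball_power by blast
  show "card {y. z \<in> out_ball V E r y} \<le> c' r" unfolding eq by (rule card_in_ball)
qed

text \<open>
The symmetrised graph has the same neighbours, hence finite balls, and these exhaust \<open>V\<close>.
\<close>

lemma countable_vertices: "countable V"
proof -
  let ?E = "E \<union> E\<inverse>"
  obtain a where a: "a \<in> V" using infinite_V by fastforce
  have sym: "?E \<subseteq> V \<times> V" using edges by blast
  have "neighbours ?E u = neighbours E u" for u by (auto simp: neighbours_def)
  then have fin: "finite (out_ball V ?E r a)" for r
    using card_out_ball_le[OF sym degree_ge_2 _ a] neighbours_bound by simp
  have "V \<subseteq> (\<Union>r. out_ball V ?E r a)"
  proof
    fix y assume "y \<in> V"
    then have "(a, y) \<in> ?E\<^sup>*" using conn a by (auto simp: weakly_connected_def)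
    then obtain n where "(a, y) \<in> ?E ^^ n" by (auto simp: rtrancl_power)
    then have "y \<in> out_ball V ?E (Suc n) a" unfolding mem_out_ball_iff[OF sym] using a by blast
    then show "y \<in> (\<Union>r. out_ball V ?E r a)" by blast
  qed
  then show ?thesis using fin by (meson countable_UN countable_finite countable_subset countableI_type)
qed

text \<open>
A closed vertex is given radius 0, which stands for an empty ball.
\<close>

lemma component_subset_explored:
  fixes Rad \<sigma> :: "'v \<Rightarrow> 'w \<Rightarrow> nat"
  defines "X \<equiv> \<lambda>\<omega> y. if \<sigma> y \<omega> = 1 then Rad y \<omega> else (0::nat)"
  shows "component_in E (wet_set V E Rad \<sigma> \<omega>) a \<subseteq> explored V (X \<omega>) {a}"
proof
  let ?W = "wet_set V E Rad \<sigma> \<omega>"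
  have W: "\<exists>y\<in>V. z \<in> out_ball V E (X \<omega> y) y" if "z \<in> ?W" for z
    using that by (auto simp: wet_set_def X_def)
  fix v assume v: "v \<in> component_in E ?W a"
  then have a: "a \<in> ?W" and path: "(a, v) \<in> ((E \<union> E\<inverse>) \<inter> ?W \<times> ?W)\<^sup>*"
    by (auto simp: component_in_def split: if_splits)
  from path show "v \<in> explored V (X \<omega>) {a}"
  proof (induction rule: rtrancl_induct)
    case base
    show ?case using W[OF a] by (blast intro: explored.seed)
  next
    case (step u z)
    show ?case
    proof (cases "z = u")
      case False
      then have "z \<in> neighbours E u" using step by (auto simp: neighbours_def)
      then show ?thesis using W[of z] step by (blast intro: explored.step)
    qed (use step in simp)
  qed
qed

end

section \<open>Choice of the exponents\<close>

text \<open>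
The mean of \<open>g r * (exp (\<kappa> * f r) - 1)\<close>, divided by \<open>\<kappa>\<close>, tends to the mean of \<open>f r * g r\<close> as \<open>\<kappa>\<close>
tends to 0.  In the subcritical case \<open>p * D\<close> times this limit is less than 1, which leaves room for
\<open>\<theta> = \<kappa> - D * K > 0\<close>.
\<close>

lemma exists_subcritical_exponent:
  fixes \<nu> :: "nat pmf" and f g :: "nat \<Rightarrow> nat" and t p D :: real
  assumes t: "t > 0" and p: "p \<ge> 0" and D: "D \<ge> 0"
    and exp_fin: "(\<integral>\<^sup>+r. ennreal (real (g r) * exp (t * f r)) \<partial>\<nu>) < \<infinity>"
    and sub: "ennreal (p * D) * (\<integral>\<^sup>+r. ennreal (real (f r) * real (g r)) \<partial>\<nu>) < 1"
  shows "\<exists>\<kappa>>0. \<exists>K\<ge>0. D * K < \<kappa> \<and>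
    ennreal p * (\<integral>\<^sup>+r. ennreal (real (g r) * (exp (\<kappa> * f r) - 1)) \<partial>\<nu>) \<le> ennreal K"
proof -
  \<comment> \<open>The sequence \<open>t / (n + 2)\<close> of candidates for \<open>\<kappa>\<close> stays below \<open>t / 2\<close>, which leaves a factor
    \<open>exp (t / 2 * f r)\<close> to absorb the factor \<open>f r\<close> of the derivative.\<close>
  define s where "s n r = real (g r) * (real (f r) * exp (t / real (n + 2) * f r))" for n r
  define w where "w r = (2 / t) * (real (g r) * exp (t * f r))" for r
  have w_int: "integrable \<nu> w"
    unfolding w_def using exp_fin by (intro integrable_mult_right integrableI_nonneg) auto
  have s_le: "s n r \<le> w r" for n r
  proof -
    have "t / real (n + 2) * f r \<le> t / 2 * f r"
      using t by (intro mult_right_mono divide_left_mono) auto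
    then have 1: "exp (t / real (n + 2) * f r) \<le> exp (t / 2 * f r)" by simp
    have "t / 2 * f r \<le> exp (t / 2 * f r)"
      using exp_ge_add_one_self[of "t / 2 * f r"] by linarith
    then have 2: "f r \<le> 2 / t * exp (t / 2 * f r)" using t by (simp add: field_simps)
    have "real (f r) * exp (t / real (n + 2) * f r) \<le> (2 / t * exp (t / 2 * f r)) * exp (t / 2 * f r)"
      using 1 2 t by (intro mult_mono) auto
    also have "\<dots> = 2 / t * exp (t * f r)" by (simp flip: exp_add)
    finally show ?thesis
      unfolding s_def w_def by (subst mult.left_commute) (intro mult_left_mono, auto)
  qed
  have s_nn: "0 \<le> s n r" for n r by (simp add: s_def)
  have s_int: "integrable \<nu> (s n)" for n
  proof (rule Bochner_Integration.integrable_bound[OF w_int], simp, rule AE_I2)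
    fix r
    show "norm (s n r) \<le> norm (w r)" using s_le[of n r] s_nn[of n r] by simp
  qed
  have lim: "(\<lambda>n. s n r) \<longlonglongrightarrow> real (f r) * real (g r)" for r
  proof -
    have "(\<lambda>n. t / real (n + 2)) \<longlonglongrightarrow> 0" by real_asymp
    then have "(\<lambda>n. real (g r) * (real (f r) * exp (t / real (n + 2) * f r))) \<longlonglongrightarrow> real (g r) * (real (f r) * exp (0 * real (f r)))"
      by (intro tendsto_intros)
    then show ?thesis by (simp add: s_def mult.commute)
  qed
  have "(\<lambda>n. \<integral>r. s n r \<partial>\<nu>) \<longlonglongrightarrow> (\<integral>r. real (f r) * real (g r) \<partial>\<nu>)"
    by (rule integral_dominated_convergence[where w = w]) (use w_int s_le s_nn lim in auto)
  moreover have "integrable \<nu> (\<lambda>r. real (f r) * real (g r))"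
  proof (rule Bochner_Integration.integrable_bound[OF w_int], simp, rule AE_I2)
    fix r
    have "real (f r) * real (g r) \<le> w r"
      using lim[of r] by (rule LIMSEQ_le_const2) (use s_le in auto)
    then show "norm (real (f r) * real (g r)) \<le> norm (w r)" by (auto simp: abs_of_nonneg)
  qed
  then have "(\<integral>\<^sup>+r. ennreal (real (f r) * real (g r)) \<partial>\<nu>) = ennreal (\<integral>r. real (f r) * real (g r) \<partial>\<nu>)"
    by (intro nn_integral_eq_integral) auto
  then have "ennreal (p * D * (\<integral>r. real (f r) * real (g r) \<partial>\<nu>)) < 1"
    using sub p D by (simp add: ennreal_mult)
  then have "p * D * (\<integral>r. real (f r) * real (g r) \<partial>\<nu>) < 1"
    by (simp flip: ennreal_1 add: ennreal_less_iff p D)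
  ultimately have "eventually (\<lambda>n. p * D * (\<integral>r. s n r \<partial>\<nu>) < 1) sequentially"
    by (intro order_tendstoD[OF tendsto_mult_left])
  then obtain n where n: "p * D * (\<integral>r. s n r \<partial>\<nu>) < 1"
    by (metis eventually_happens sequentially_bot)
  define \<kappa> where "\<kappa> = t / real (n + 2)"
  define K where "K = p * (\<kappa> * (\<integral>r. s n r \<partial>\<nu>))"
  have \<kappa>: "\<kappa> > 0" using t by (simp add: \<kappa>_def)
  have I: "(\<integral>r. s n r \<partial>\<nu>) \<ge> 0" by (rule Bochner_Integration.integral_nonneg) (rule s_nn)
  have "D * K = \<kappa> * (p * D * (\<integral>r. s n r \<partial>\<nu>))" by (simp add: K_def)
  also have "\<dots> < \<kappa> * 1" by (rule mult_strict_left_mono[OF n \<kappa>])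
  finally have "D * K < \<kappa>" by simp
  moreover have "K \<ge> 0" using p \<kappa> I by (simp add: K_def)
  moreover have "ennreal p * (\<integral>\<^sup>+r. ennreal (real (g r) * (exp (\<kappa> * f r) - 1)) \<partial>\<nu>) \<le> ennreal K"
  proof -
    have "real (g r) * (exp (\<kappa> * f r) - 1) \<le> \<kappa> * s n r" for r
    proof -
      let ?x = "\<kappa> * f r"
      have "exp ?x * (1 - ?x) \<le> exp ?x * exp (- ?x)"
        using exp_ge_add_one_self[of "- ?x"] by (intro mult_left_mono) auto
      then have "exp ?x - 1 \<le> ?x * exp ?x" by (simp add: algebra_simps flip: exp_add)
      then have "real (g r) * (exp ?x - 1) \<le> real (g r) * (?x * exp ?x)" by (intro mult_left_mono) auto
      then show ?thesis by (simp add: s_def \<kappa>_def mult_ac)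
    qed
    then have "(\<integral>\<^sup>+r. ennreal (real (g r) * (exp (\<kappa> * f r) - 1)) \<partial>\<nu>) \<le> (\<integral>\<^sup>+r. ennreal (\<kappa> * s n r) \<partial>\<nu>)"
      by (intro nn_integral_mono ennreal_leI)
    also have "\<dots> = ennreal (\<kappa> * (\<integral>r. s n r \<partial>\<nu>))"
      using s_int \<kappa> s_nn by (subst nn_integral_eq_integral) auto
    finally have "ennreal p * (\<integral>\<^sup>+r. ennreal (real (g r) * (exp (\<kappa> * f r) - 1)) \<partial>\<nu>)
        \<le> ennreal p * ennreal (\<kappa> * (\<integral>r. s n r \<partial>\<nu>))"
      by (intro mult_left_mono) auto
    then show ?thesis using p \<kappa> I by (simp add: K_def ennreal_mult)
  qed
  ultimately show ?thesis using \<kappa> by blast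
qed

text \<open>
A constant factor in an exponential bound can be removed by lowering the rate, as soon as the
probabilities are also bounded by a constant \<open>q < 1\<close>: the latter bound is used up to \<open>2 * K / \<theta> + 1\<close>.
\<close>

lemma exists_exponential_rate:
  fixes q \<theta> K :: real
  assumes q: "q < 1" and \<theta>: "\<theta> > 0" and K: "K \<ge> 0"
  shows "\<exists>l>0. \<forall>n::nat. min q (exp (K - \<theta> * n)) \<le> exp (- l * n)"
proof -
  define q' where "q' = max q (1 / 2)"
  have q': "0 < q'" "q' < 1" "q \<le> q'" using q by (auto simp: q'_def)
  define m where "m = 2 * K / \<theta> + 1"
  have m: "m > 0" using K \<theta> by (simp add: m_def add_nonneg_pos)
  define l where "l = min (\<theta> / 2) (- ln q' / m)"
  have "l > 0" using \<theta> m q' by (simp add: l_def divide_neg_pos)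
  moreover have "min q (exp (K - \<theta> * n)) \<le> exp (- l * n)" for n :: nat
  proof (cases "real n \<le> m")
    case True
    have "l * n \<le> (- ln q' / m) * m"
      using True \<open>l > 0\<close> m q' by (intro mult_mono) (auto simp: l_def divide_nonpos_pos)
    then have "ln q' \<le> - l * n" using m by simp
    then have "exp (ln q') \<le> exp (- l * n)" by (simp only: exp_le_cancel_iff)
    then show ?thesis using q' by simp
  next
    case False
    then have "2 * K / \<theta> \<le> n" by (simp add: m_def)
    then have "2 * K \<le> \<theta> * n" using \<theta> by (simp add: field_simps)
    moreover have "l * n \<le> \<theta> / 2 * n"
      unfolding l_def by (intro mult_right_mono min.cobounded1) simp
    ultimately have "K - \<theta> * n \<le> - l * n" by simp
    then have "exp (K - \<theta> * n) \<le> exp (- l * n)" by simp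
    then show ?thesis by linarith
  qed
  ultimately show ?thesis by blast
qed

section \<open>The law of finitely many radii\<close>

text \<open>
If the finite-dimensional point probabilities of a family of discrete variables are products, then
its restriction to \<open>F\<close>, extended by a default value, has the law \<^const>\<open>Pi_pmf\<close>.
\<close>

lemma (in prob_space) Pi_pmf_law:
  fixes Z :: "'v \<Rightarrow> 'a \<Rightarrow> 'b :: countable" and q :: "'v \<Rightarrow> 'b pmf" and d :: 'b
  assumes F: "finite F"
    and meas: "\<And>y. y \<in> F \<Longrightarrow> Z y \<in> M \<rightarrow>\<^sub>M count_space UNIV"
    and law: "\<And>z. prob {\<omega> \<in> space M. \<forall>y\<in>F. Z y \<omega> = z y} = (\<Prod>y\<in>F. pmf (q y) (z y))"
  defines "\<zeta> \<equiv> \<lambda>\<omega> y. if y \<in> F then Z y \<omega> else d"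
  shows "{\<omega> \<in> space M. Q (\<zeta> \<omega>)} \<in> events"
    and "emeasure M {\<omega> \<in> space M. Q (\<zeta> \<omega>)} = emeasure (Pi_pmf F d q) {z. Q z}"
proof -
  define T where "T = {z \<in> PiE_dflt F d (\<lambda>_. UNIV). Q z}"
  define C where "C z = {\<omega> \<in> space M. \<forall>y\<in>F. Z y \<omega> = z y}" for z
  have "countable (PiE_dflt F d (\<lambda>_. UNIV :: 'b set))"
    unfolding dflt_image_PiE[symmetric] using F by (intro countable_image countable_PiE) auto
  then have T: "countable T" unfolding T_def by (rule countable_subset[rotated]) auto
  have C_ev: "C z \<in> events" for z
    unfolding C_def using F meas by measurable
  have C_iff: "\<omega> \<in> C z \<longleftrightarrow> \<omega> \<in> space M \<and> \<zeta> \<omega> = z" if "z \<in> PiE_dflt F d (\<lambda>_. UNIV)" for z \<omega>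
    using that by (auto simp: C_def \<zeta>_def PiE_dflt_def fun_eq_iff)
  have \<zeta>_mem: "\<zeta> \<omega> \<in> PiE_dflt F d (\<lambda>_. UNIV)" for \<omega> by (auto simp: \<zeta>_def PiE_dflt_def)
  have eq: "{\<omega> \<in> space M. Q (\<zeta> \<omega>)} = (\<Union>z\<in>T. C z)"
    using C_iff \<zeta>_mem by (auto simp: T_def)
  show "{\<omega> \<in> space M. Q (\<zeta> \<omega>)} \<in> events"
    unfolding eq using T C_ev by (intro sets.countable_UN'') auto
  have "disjoint_family_on C T"
    unfolding disjoint_family_on_def using C_iff by (auto simp: T_def)
  then have "emeasure M (\<Union>z\<in>T. C z) = (\<integral>\<^sup>+z. emeasure M (C z) \<partial>count_space T)"
    using T C_ev by (intro emeasure_UN_countable) auto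
  also have "\<dots> = (\<integral>\<^sup>+z. pmf (Pi_pmf F d q) z \<partial>count_space T)"
  proof (intro nn_integral_cong)
    fix z assume "z \<in> space (count_space T)"
    then have "z \<in> PiE_dflt F d (\<lambda>_. UNIV)" by (auto simp: T_def)
    then have "pmf (Pi_pmf F d q) z = (\<Prod>y\<in>F. pmf (q y) (z y))"
      by (intro pmf_Pi'[OF F]) (auto simp: PiE_dflt_def)
    then show "emeasure M (C z) = pmf (Pi_pmf F d q) z"
      using law[of z] by (simp add: C_def emeasure_eq_measure)
  qed
  also have "\<dots> = emeasure (Pi_pmf F d q) T" by (rule nn_integral_pmf)
  also have "\<dots> = emeasure (Pi_pmf F d q) {z. Q z}"
  proof (rule emeasure_eq_AE)
    show "AE z in Pi_pmf F d q. z \<in> T \<longleftrightarrow> z \<in> {z. Q z}"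
      using set_Pi_pmf_subset'[OF F, of d q] by (auto simp: AE_measure_pmf_iff T_def PiE_dflt_def)
  qed auto
  finally show "emeasure M {\<omega> \<in> space M. Q (\<zeta> \<omega>)} = emeasure (Pi_pmf F d q) {z. Q z}"
    by (simp add: eq)
qed

context boolean_percolation begin

text \<open>
The effective radius of a vertex, with value 0 when the vertex is closed, and its law \<open>\<mu>\<close>.
\<close>

definition X :: "'v \<Rightarrow> 'w \<Rightarrow> nat" where
  "X y \<omega> = (if \<sigma> y \<omega> = 1 then Rad y \<omega> else 0)"

definition \<mu> :: "nat pmf" where
  "\<mu> = map_pmf (\<lambda>(r, s). if s = 1 then r else 0) (pair_pmf \<nu> (map_pmf of_bool (bernoulli_pmf p) :: nat pmf))"

lemma prob_Rad_sigma_pattern: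
  assumes F: "finite F" "F \<subseteq> V"
  shows "prob {\<omega> \<in> space M. \<forall>y\<in>F. (Rad y \<omega>, \<sigma> y \<omega>) = z y}
    = (\<Prod>y\<in>F. pmf (pair_pmf \<nu> (map_pmf of_bool (bernoulli_pmf p))) (z y))"
proof (cases "F = {}")
  case True
  then show ?thesis by (simp add: prob_space)
next
  case False
  let ?S = "\<Pi>\<^sub>M x\<in>V. count_space (UNIV :: nat set)"
  have RV: "Rad y \<in> M \<rightarrow>\<^sub>M count_space UNIV" "\<sigma> y \<in> M \<rightarrow>\<^sub>M count_space UNIV" if "y \<in> V" for y
    using indep_Rad indep_sigma that by (auto simp: indep_vars_def)
  have marg: "prob (\<Inter>y\<in>F. Y y -` {u y} \<inter> space M) = (\<Prod>y\<in>F. pmf q (u y))"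
    if ind: "indep_vars (\<lambda>_. count_space UNIV) Y V"
      and lawY: "\<And>y. y \<in> V \<Longrightarrow> distr M (count_space UNIV) (Y y) = measure_pmf q"
    for Y :: "'v \<Rightarrow> 'w \<Rightarrow> nat" and u q
  proof -
    have "prob (\<Inter>y\<in>F. Y y -` {u y} \<inter> space M) = (\<Prod>y\<in>F. prob (Y y -` {u y} \<inter> space M))"
      using F False by (intro indep_varsD[OF ind]) auto
    also have "\<dots> = (\<Prod>y\<in>F. pmf q (u y))"
    proof (rule prod.cong)
      fix y assume "y \<in> F"
      then have y: "y \<in> V" using F by blast
      have "Y y \<in> M \<rightarrow>\<^sub>M count_space UNIV" using ind y by (auto simp: indep_vars_def)
      then have "prob (Y y -` {u y} \<inter> space M) = measure (distr M (count_space UNIV) (Y y)) {u y}"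
        by (simp add: measure_distr)
      then show "prob (Y y -` {u y} \<inter> space M) = pmf q (u y)"
        by (simp add: lawY[OF y] measure_pmf_single)
    qed simp
    finally show ?thesis .
  qed
  define cyl where "cyl u = {f \<in> space ?S. \<forall>y\<in>F. f y = u y}" for u :: "'v \<Rightarrow> nat"
  have cyl: "cyl u \<in> sets ?S" for u
  proof -
    have "{f \<in> space ?S. f y = u y} \<in> sets ?S" if "y \<in> F" for y
    proof -
      have "(\<lambda>f. f y) \<in> ?S \<rightarrow>\<^sub>M count_space UNIV"
        using that F by (intro measurable_component_singleton) auto
      from measurable_sets[OF this, of "{u y}"] show ?thesis by (simp add: vimage_def Int_def conj_commute)
    qed
    then have "(\<Inter>y\<in>F. {f \<in> space ?S. f y = u y}) \<in> sets ?S"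
      using F False by (intro sets.finite_INT) auto
    also have "(\<Inter>y\<in>F. {f \<in> space ?S. f y = u y}) = cyl u" using False by (auto simp: cyl_def)
    finally show ?thesis .
  qed
  have pre: "(\<lambda>\<omega>. \<lambda>x\<in>V. Y x \<omega>) -` cyl u \<inter> space M = (\<Inter>y\<in>F. Y y -` {u y} \<inter> space M)"
    for Y :: "'v \<Rightarrow> 'w \<Rightarrow> nat" and u
    using F False by (auto simp: cyl_def space_PiM)
  have "{\<omega> \<in> space M. \<forall>y\<in>F. (Rad y \<omega>, \<sigma> y \<omega>) = z y}
      = (\<lambda>\<omega>. (\<lambda>x\<in>V. Rad x \<omega>, \<lambda>x\<in>V. \<sigma> x \<omega>)) -` (cyl (\<lambda>y. fst (z y)) \<times> cyl (\<lambda>y. snd (z y))) \<inter> space M"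
    using subsetD[OF F(2)] by (auto simp: cyl_def space_PiM prod_eq_iff)
  then have "prob {\<omega> \<in> space M. \<forall>y\<in>F. (Rad y \<omega>, \<sigma> y \<omega>) = z y}
      = prob (\<Inter>y\<in>F. Rad y -` {fst (z y)} \<inter> space M) * prob (\<Inter>y\<in>F. \<sigma> y -` {snd (z y)} \<inter> space M)"
    using indep_varD[OF indep_Rad_sigma cyl cyl] by (simp only: pre)
  also have "\<dots> = (\<Prod>y\<in>F. pmf \<nu> (fst (z y)))
      * (\<Prod>y\<in>F. pmf (map_pmf of_bool (bernoulli_pmf p)) (snd (z y)))"
    using marg[OF indep_Rad law_Rad] marg[OF indep_sigma law_sigma] by simp
  also have "\<dots> = (\<Prod>y\<in>F. pmf (pair_pmf \<nu> (map_pmf of_bool (bernoulli_pmf p))) (fst (z y), snd (z y)))"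
    by (simp only: pmf_pair prod.distrib)
  finally show ?thesis by simp
qed

text \<open>
An event that depends only on the radii in the finite set \<open>F\<close> has the same probability for the
percolation model as for independent radii with law \<open>\<mu>\<close>.
\<close>

lemma law_X:
  assumes F: "finite F" "F \<subseteq> V"
    and Q: "\<And>x x'. (\<And>y. y \<in> F \<Longrightarrow> x y = x' y) \<Longrightarrow> Q x = Q x'"
  shows "{\<omega> \<in> space M. Q (\<lambda>y. X y \<omega>)} \<in> events"
    and "emeasure M {\<omega> \<in> space M. Q (\<lambda>y. X y \<omega>)} = emeasure (Pi_pmf F 0 (\<lambda>_. \<mu>)) {x. Q x}"
proof -
  let ?g = "\<lambda>(r, s). if s = (1 :: nat) then r else (0 :: nat)"
  let ?q = "pair_pmf \<nu> (map_pmf of_bool (bernoulli_pmf p) :: nat pmf)"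
  let ?\<zeta> = "\<lambda>\<omega> y. if y \<in> F then (Rad y \<omega>, \<sigma> y \<omega>) else (0, 0)"
  have meas: "(\<lambda>\<omega>. (Rad y \<omega>, \<sigma> y \<omega>)) \<in> M \<rightarrow>\<^sub>M count_space UNIV" if "y \<in> F" for y
  proof -
    have "Rad y \<in> M \<rightarrow>\<^sub>M count_space UNIV" "\<sigma> y \<in> M \<rightarrow>\<^sub>M count_space UNIV"
      using indep_Rad indep_sigma that F by (auto simp: indep_vars_def)
    then have "(\<lambda>\<omega>. (Rad y \<omega>, \<sigma> y \<omega>)) \<in> M \<rightarrow>\<^sub>M count_space UNIV \<Otimes>\<^sub>M count_space UNIV" by measurable
    then show ?thesis by (simp add: pair_measure_countable)
  qed
  have eq: "{\<omega> \<in> space M. Q (\<lambda>y. X y \<omega>)} = {\<omega> \<in> space M. Q (?g \<circ> ?\<zeta> \<omega>)}"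
    by (intro Collect_cong conj_cong refl Q) (simp add: X_def)
  note law = Pi_pmf_law[where d = "(0, 0)" and Q = "\<lambda>z. Q (?g \<circ> z)",
      OF F(1) meas prob_Rad_sigma_pattern[OF F]]
  show "{\<omega> \<in> space M. Q (\<lambda>y. X y \<omega>)} \<in> events"
    unfolding eq by (rule law(1))
  have "emeasure M {\<omega> \<in> space M. Q (\<lambda>y. X y \<omega>)} = emeasure (Pi_pmf F (0, 0) (\<lambda>_. ?q)) {z. Q (?g \<circ> z)}"
    unfolding eq by (rule law(2))
  also have "\<dots> = emeasure (map_pmf (\<lambda>h. ?g \<circ> h) (Pi_pmf F (0, 0) (\<lambda>_. ?q))) {x. Q x}"
    by (simp add: vimage_def)
  also have "map_pmf (\<lambda>h. ?g \<circ> h) (Pi_pmf F (0, 0) (\<lambda>_. ?q)) = Pi_pmf F 0 (\<lambda>_. \<mu>)"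
    unfolding \<mu>_def by (rule Pi_pmf_map[symmetric]) (use F in auto)
  finally show "emeasure M {\<omega> \<in> space M. Q (\<lambda>y. X y \<omega>)} = emeasure (Pi_pmf F 0 (\<lambda>_. \<mu>)) {x. Q x}" .
qed

lemma nn_integral_\<mu>:
  assumes p: "p \<in> {0..1}" and f: "f 0 = 0"
  shows "(\<integral>\<^sup>+r. f r \<partial>\<mu>) = ennreal p * (\<integral>\<^sup>+r. f r \<partial>\<nu>)"
proof -
  have "(\<integral>\<^sup>+r. f r \<partial>\<mu>) = (\<integral>\<^sup>+r. f r * ennreal p \<partial>\<nu>)"
    using p by (simp add: \<mu>_def nn_integral_pair_pmf' f split_def)
  then show ?thesis by (simp add: nn_integral_cmult mult.commute)
qed

end

section \<open>Exponential decay of the cluster\<close>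

context bounded_graph begin

text \<open>
The moment condition through the degree: \<open>c r\<close> and \<open>c' r\<close> are at most \<open>\<Delta> ^ r\<close>, the sum over \<open>r\<close> is
dominated by twice its last term, and the factor \<open>\<Delta> ^ n\<close> is absorbed by doubling the exponent.
\<close>

lemma psi_finite:
  assumes t: "t > 0"
    and fin: "(\<integral>\<^sup>+\<omega>. ennreal (exp (2 * t * real \<Delta> ^ R \<omega>)) \<partial>N) < \<infinity>"
    and R: "R \<in> N \<rightarrow>\<^sub>M count_space UNIV"
  shows "(\<integral>\<^sup>+\<omega>. ennreal (psi V E t (R \<omega>)) \<partial>N) < \<infinity>"
proof -
  have geo: "(\<Sum>r=1..n. real \<Delta> ^ r) \<le> 2 * real \<Delta> ^ n" for n
  proof (induction n)
    case (Suc n)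
    have "2 * real \<Delta> ^ n \<le> real \<Delta> ^ Suc n" using degree_ge_2 by simp
    then show ?case using Suc.IH by simp
  qed simp
  have bound: "psi V E t n \<le> 2 / t * exp (2 * t * real \<Delta> ^ n)" for n
  proof -
    let ?d = "real \<Delta> ^ n"
    have "psi V E t n = (\<Sum>r=1..n. real (c' r) * exp (t * real (c r)))"
      by (simp add: psi_def c_def c'_def)
    also have "\<dots> \<le> (\<Sum>r=1..n. real \<Delta> ^ r * exp (t * ?d))"
    proof (rule sum_mono)
      fix r assume r: "r \<in> {1..n}"
      have "real (c r) \<le> real \<Delta> ^ r"
        using c_less_power[of r] by (simp flip: of_nat_power)
      also have "\<dots> \<le> ?d" using r degree_ge_2 by (intro power_increasing) auto
      finally have "exp (t * c r) \<le> exp (t * ?d)" using t by simp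
      moreover have "real (c' r) \<le> real \<Delta> ^ r"
        using c'_less_power[of r] by (simp flip: of_nat_power)
      ultimately show "real (c' r) * exp (t * real (c r)) \<le> real \<Delta> ^ r * exp (t * ?d)"
        by (intro mult_mono) auto
    qed
    also have "\<dots> \<le> (2 * ?d) * exp (t * ?d)"
      unfolding sum_distrib_right[symmetric] by (intro mult_right_mono geo) auto
    also have "\<dots> \<le> (2 / t * exp (t * ?d)) * exp (t * ?d)"
    proof (rule mult_right_mono)
      have "t * ?d \<le> exp (t * ?d)" using exp_ge_add_one_self[of "t * ?d"] by linarith
      then show "2 * ?d \<le> 2 / t * exp (t * ?d)" using t by (simp add: field_simps)
    qed simp
    also have "\<dots> = 2 / t * exp (2 * t * ?d)" by (simp flip: exp_add)
    finally show ?thesis .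
  qed
  have "(\<integral>\<^sup>+\<omega>. ennreal (psi V E t (R \<omega>)) \<partial>N)
      \<le> (\<integral>\<^sup>+\<omega>. ennreal (2 / t) * ennreal (exp (2 * t * real \<Delta> ^ R \<omega>)) \<partial>N)"
  proof (rule nn_integral_mono)
    fix \<omega>
    show "ennreal (psi V E t (R \<omega>)) \<le> ennreal (2 / t) * ennreal (exp (2 * t * real \<Delta> ^ R \<omega>))"
      using ennreal_leI[OF bound[of "R \<omega>"]] t by (subst ennreal_mult[symmetric]) auto
  qed
  also have "\<dots> = ennreal (2 / t) * (\<integral>\<^sup>+\<omega>. ennreal (exp (2 * t * real \<Delta> ^ R \<omega>)) \<partial>N)"
    using R by (intro nn_integral_cmult) measurable
  also have "\<dots> < \<infinity>" using fin by (simp add: ennreal_mult_less_top)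
  finally show ?thesis .
qed

lemma phi_ge: "1 \<le> n \<Longrightarrow> real \<Delta> * (real (c n) * real (c' n)) \<le> phi V E n"
  unfolding phi_def c_def[symmetric] c'_def[symmetric] \<Delta>_def[symmetric]
  by (intro mult_left_mono member_le_sum) auto

lemma psi_ge: "1 \<le> n \<Longrightarrow> real (c' n) * exp (t * real (c n)) \<le> psi V E t n"
  unfolding psi_def c_def[symmetric] c'_def[symmetric]
  by (intro member_le_sum) auto

text \<open>
The bounds for finitely many centres pass to the limit along an exhausting sequence of finite sets
of centres.  The event on the left need not be known to be measurable, since it is contained in a
measurable one.
\<close>

lemma cluster_tail:
  fixes M :: "'w measure" and \<nu> :: "nat pmf"
  assumes perc: "boolean_percolation M V \<nu> p Rad \<sigma>" and p: "p \<in> {0..1}" and \<rho>: "\<rho> \<in> V"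
    and \<theta>: "\<theta> \<ge> 0" and K: "K \<ge> 0" and \<kappa>: "\<kappa> = \<theta> + real \<Delta> * K"
    and int: "ennreal p * (\<integral>\<^sup>+r. ennreal (real (c' r) * (exp (\<kappa> * c r) - 1)) \<partial>\<nu>) \<le> ennreal K"
    and cover: "ennreal p * (\<integral>\<^sup>+r. of_nat (c' r) \<partial>\<nu>) \<le> ennreal q" and q: "q \<ge> 0"
  shows "measure M {\<omega> \<in> space M. ecard (component_in E (wet_set V E Rad \<sigma> \<omega>) \<rho>) > enat n}
    \<le> min q (exp (K - \<theta> * n))"
proof -
  interpret boolean_percolation M V \<nu> p Rad \<sigma> by fact
  define F where "F k = from_nat_into V ` {..k}" for k
  have V: "V \<noteq> {}" using \<rho> by blast
  have F: "finite (F k)" "F k \<subseteq> V" for k using from_nat_into[OF V] by (auto simp: F_def)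
  have mono_F: "mono F" by (auto simp: F_def mono_def)
  have UN_F: "(\<Union>k. F k) = V"
    using F(2) from_nat_into_surj[OF countable_vertices] by (fastforce simp: F_def)
  define Q where "Q k x \<longleftrightarrow> n < card (explored (F k) x {\<rho>})" for k x
  have Q_cong: "Q k x = Q k x'" if "\<And>y. y \<in> F k \<Longrightarrow> x y = x' y" for k x x'
    using explored_cong[of "F k" x x'] that by (simp add: Q_def)
  define A where "A k = {\<omega> \<in> space M. Q k (\<lambda>y. X y \<omega>)}" for k
  have A_ev: "A k \<in> events" for k unfolding A_def by (rule law_X(1)[OF F Q_cong])
  have A_le: "prob (A k) \<le> min q (exp (K - \<theta> * n))" for k
  proof -
    have eq: "emeasure M (A k) = emeasure (Pi_pmf (F k) 0 (\<lambda>_. \<mu>)) {x. Q k x}"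
      unfolding A_def by (rule law_X(2)[OF F Q_cong])
    have "emeasure M (A k) \<le> emeasure (Pi_pmf (F k) 0 (\<lambda>_. \<mu>)) {x. explored (F k) x {\<rho>} \<noteq> {}}"
      unfolding eq by (intro emeasure_mono) (auto simp: Q_def)
    also have "\<dots> \<le> (\<integral>\<^sup>+r. of_nat (c' r) \<partial>\<mu>)" by (rule prob_explored_nonempty[OF F(1)])
    also have "\<dots> \<le> ennreal q" using cover by (subst nn_integral_\<mu>[OF p]) (simp_all add: c'_0)
    finally have 1: "prob (A k) \<le> q" using q by (simp add: emeasure_eq_measure)
    have "(\<integral>\<^sup>+r. ennreal (real (c' r) * (exp (\<kappa> * c r) - 1)) \<partial>\<mu>) \<le> ennreal K"
      using int by (subst nn_integral_\<mu>[OF p]) (simp_all add: c'_0)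
    from prob_card_explored_gt[OF \<theta> K \<kappa> this F(1)]
    have "emeasure M (A k) \<le> ennreal (exp (K - \<theta> * n))" unfolding eq Q_def .
    then have 2: "prob (A k) \<le> exp (K - \<theta> * n)" by (simp add: emeasure_eq_measure)
    show ?thesis using 1 2 by simp
  qed
  have A_mono: "incseq A"
  proof (rule monoI)
    fix j k :: nat assume "j \<le> k"
    then have "explored (F j) x {\<rho>} \<subseteq> explored (F k) x {\<rho>}" for x
      using monoD[OF mono_F] by (intro explored_mono) auto
    then have "card (explored (F j) x {\<rho>}) \<le> card (explored (F k) x {\<rho>})" for x
      by (intro card_mono finite_explored F)
    then show "A j \<subseteq> A k" by (auto simp: A_def Q_def intro: less_le_trans)
  qed
  have "(\<lambda>k. prob (A k)) \<longlonglongrightarrow> prob (\<Union>k. A k)"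
    using A_ev A_mono by (intro finite_Lim_measure_incseq) auto
  then have "prob (\<Union>k. A k) \<le> min q (exp (K - \<theta> * n))"
    by (rule LIMSEQ_le_const2) (use A_le in auto)
  moreover have "{\<omega> \<in> space M. ecard (component_in E (wet_set V E Rad \<sigma> \<omega>) \<rho>) > enat n} \<subseteq> (\<Union>k. A k)"
  proof
    fix \<omega> assume "\<omega> \<in> {\<omega> \<in> space M. ecard (component_in E (wet_set V E Rad \<sigma> \<omega>) \<rho>) > enat n}"
    then have \<omega>: "\<omega> \<in> space M" and big: "ecard (component_in E (wet_set V E Rad \<sigma> \<omega>) \<rho>) > enat n" by auto
    let ?C = "component_in E (wet_set V E Rad \<sigma> \<omega>) \<rho>"
    have "\<exists>D\<subseteq>?C. finite D \<and> card D = Suc n"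
    proof (cases "finite ?C")
      case True
      then have "Suc n \<le> card ?C" using big by (simp add: ecard_def)
      then show ?thesis by (metis obtain_subset_with_card_n)
    next
      case False
      then show ?thesis by (metis infinite_arbitrarily_large)
    qed
    then obtain D where D: "D \<subseteq> ?C" "finite D" "card D = Suc n" by blast
    have "D \<subseteq> explored (\<Union>k. F k) (\<lambda>y. X y \<omega>) {\<rho>}"
      using D(1) component_subset_explored[of Rad \<sigma> \<omega> \<rho>] by (auto simp: UN_F X_def[abs_def])
    from explored_finite_approx[OF mono_F D(2) this]
    obtain k where "D \<subseteq> explored (F k) (\<lambda>y. X y \<omega>) {\<rho>}" by blast
    then have "card D \<le> card (explored (F k) (\<lambda>y. X y \<omega>) {\<rho>})"
      by (intro card_mono finite_explored F)
    then have "\<omega> \<in> A k" using \<omega> D by (simp add: A_def Q_def)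
    then show "\<omega> \<in> (\<Union>k. A k)" by blast
  qed
  then have "measure M {\<omega> \<in> space M. ecard (component_in E (wet_set V E Rad \<sigma> \<omega>) \<rho>) > enat n} \<le> prob (\<Union>k. A k)"
    by (rule finite_measure_mono) (use A_ev in auto)
  ultimately show ?thesis by linarith
qed

lemma exponential_rate:
  fixes \<nu> :: "nat pmf"
  assumes support: "set_pmf \<nu> \<subseteq> {1..}" and \<rho>: "\<rho> \<in> V"
    and phi_fin: "(\<integral>\<^sup>+r. ennreal (phi V E r) \<partial>\<nu>) < \<infinity>"
    and t: "t > 0" and psi_fin: "(\<integral>\<^sup>+r. ennreal (psi V E t r) \<partial>\<nu>) < \<infinity>"
    and p: "p \<in> {0..1}" and p_less: "ennreal p < inverse (\<integral>\<^sup>+r. ennreal (phi V E r) \<partial>\<nu>)"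
  shows "\<exists>l>0. \<forall>(M :: 'w measure) Rad \<sigma>. boolean_percolation M V \<nu> p Rad \<sigma> \<longrightarrow>
    (\<forall>n. measure M {\<omega> \<in> space M. ecard (component_in E (wet_set V E Rad \<sigma> \<omega>) \<rho>) > enat n}
      \<le> exp (- l * real n))"
proof -
  have AE1: "AE r in \<nu>. 1 \<le> r" using support by (auto simp: AE_measure_pmf_iff)
  let ?I = "\<integral>\<^sup>+r. ennreal (phi V E r) \<partial>\<nu>"
  have sub: "ennreal p * ?I < 1"
  proof (cases "?I = 0")
    case False
    then have "ennreal p * ?I < inverse ?I * ?I"
      using p_less phi_fin by (intro ennreal_mult_strict_right_mono) (auto simp: zero_less_iff_neq_zero)
    also have "inverse ?I * ?I = 1"
      using ennreal_divide_self[OF False] phi_fin by (simp add: divide_ennreal_def mult.commute)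
    finally show ?thesis .
  qed simp
  have "(\<integral>\<^sup>+r. ennreal (real (c' r) * exp (t * c r)) \<partial>\<nu>) \<le> (\<integral>\<^sup>+r. ennreal (psi V E t r) \<partial>\<nu>)"
    by (rule nn_integral_mono_AE, rule AE_mp[OF AE1]) (auto intro!: AE_I2 ennreal_leI psi_ge)
  then have exp_fin: "(\<integral>\<^sup>+r. ennreal (real (c' r) * exp (t * c r)) \<partial>\<nu>) < \<infinity>"
    using psi_fin by (rule le_less_trans)
  have "ennreal (p * \<Delta>) * (\<integral>\<^sup>+r. ennreal (real (c r) * real (c' r)) \<partial>\<nu>)
      = ennreal p * (\<integral>\<^sup>+r. ennreal (real \<Delta> * (real (c r) * real (c' r))) \<partial>\<nu>)"
    using p by (simp add: ennreal_mult nn_integral_cmult mult.assoc)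
  also have "\<dots> \<le> ennreal p * ?I"
    by (intro mult_left_mono, rule nn_integral_mono_AE, rule AE_mp[OF AE1])
      (auto intro!: AE_I2 ennreal_leI phi_ge)
  finally have sub': "ennreal (p * \<Delta>) * (\<integral>\<^sup>+r. ennreal (real (c r) * real (c' r)) \<partial>\<nu>) < 1"
    using sub by (rule le_less_trans)
  have "ennreal p * (\<integral>\<^sup>+r. of_nat (c' r) \<partial>\<nu>) \<le> ennreal p * ?I"
  proof (intro mult_left_mono, rule nn_integral_mono_AE, rule AE_mp[OF AE1], intro AE_I2 impI)
    fix r :: nat assume r: "1 \<le> r"
    have "1 * (1 * real (c' r)) \<le> real \<Delta> * (real (c r) * real (c' r))"
      using degree_ge_2 c_pos[OF r] by (intro mult_mono) auto
    also have "\<dots> \<le> phi V E r" by (rule phi_ge[OF r])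
    finally show "of_nat (c' r) \<le> ennreal (phi V E r)"
      by (simp add: ennreal_of_nat_eq_real_of_nat ennreal_leI)
  qed simp
  then have cover: "ennreal p * (\<integral>\<^sup>+r. of_nat (c' r) \<partial>\<nu>) < 1" using sub by (rule le_less_trans)
  define q where "q = enn2real (ennreal p * (\<integral>\<^sup>+r. of_nat (c' r) \<partial>\<nu>))"
  have fin: "ennreal p * (\<integral>\<^sup>+r. of_nat (c' r) \<partial>\<nu>) < \<top>" using cover by (rule less_trans) simp
  have qe: "ennreal p * (\<integral>\<^sup>+r. of_nat (c' r) \<partial>\<nu>) = ennreal q"
    unfolding q_def using fin by simp
  have q: "0 \<le> q" "q < 1"
    using cover unfolding qe by (auto simp: q_def simp flip: ennreal_1 simp: ennreal_less_iff)
  obtain \<kappa> K where \<kappa>: "\<kappa> > 0" and K: "K \<ge> 0" "real \<Delta> * K < \<kappa>"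
    and int: "ennreal p * (\<integral>\<^sup>+r. ennreal (real (c' r) * (exp (\<kappa> * c r) - 1)) \<partial>\<nu>) \<le> ennreal K"
    using exists_subcritical_exponent[OF t _ _ exp_fin sub'] p by auto
  define \<theta> where "\<theta> = \<kappa> - real \<Delta> * K"
  have \<theta>: "\<theta> > 0" "\<kappa> = \<theta> + real \<Delta> * K" using K by (auto simp: \<theta>_def)
  obtain l where l: "l > 0" "\<And>n::nat. min q (exp (K - \<theta> * n)) \<le> exp (- l * n)"
    using exists_exponential_rate[OF q(2) \<theta>(1) K(1)] by blast
  show ?thesis
  proof (intro exI[of _ l] conjI allI impI l(1))
    fix M :: "'w measure" and Rad \<sigma> n
    assume "boolean_percolation M V \<nu> p Rad \<sigma>"
    then have "measure M {\<omega> \<in> space M. ecard (component_in E (wet_set V E Rad \<sigma> \<omega>) \<rho>) > enat n}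
        \<le> min q (exp (K - \<theta> * n))"
      using qe \<theta>(1) by (intro cluster_tail[OF _ p \<rho> _ K(1) \<theta>(2) int _ q(1)]) auto
    also have "\<dots> \<le> exp (- l * real n)" by (rule l(2))
    finally show "measure M {\<omega> \<in> space M. ecard (component_in E (wet_set V E Rad \<sigma> \<omega>) \<rho>) > enat n} \<le> exp (- l * real n)" .
  qed
qed

end

theorem theorem2:
  fixes V :: "'v set" and E :: "('v \<times> 'v) set" and \<rho> :: 'v
    and \<nu> :: "nat pmf" and N :: "'a measure" and R :: "'a \<Rightarrow> nat"
  assumes edges: "E \<subseteq> V \<times> V"
    and infinite_V: "infinite V"
    and conn: "weakly_connected V E"
    and bounded: "bounded_degree V E"
    and root: "\<rho> \<in> V"
    and support: "set_pmf \<nu> \<subseteq> {1..}"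
    and N: "prob_space N"
    and R: "R \<in> N \<rightarrow>\<^sub>M count_space UNIV"
    and law_R: "distr N (count_space UNIV) R = measure_pmf \<nu>"
  shows "((\<integral>\<^sup>+\<omega>. ennreal (phi V E (R \<omega>)) \<partial>N) < \<infinity> \<longrightarrow>
          (\<exists>t>0. (\<integral>\<^sup>+\<omega>. ennreal (psi V E t (R \<omega>)) \<partial>N) < \<infinity>) \<longrightarrow>
          (\<forall>p\<in>{0..1}. ennreal p < inverse (\<integral>\<^sup>+\<omega>. ennreal (phi V E (R \<omega>)) \<partial>N) \<longrightarrow>
            (\<exists>l::real. l > 0 \<and>
              (\<forall>(M :: 'w measure) Rad \<sigma>. boolean_percolation M V \<nu> p Rad \<sigma> \<longrightarrow>
                (\<forall>n::nat.
                  measure M {\<omega> \<in> space M. ecard (component_in E (wet_set V E Rad \<sigma> \<omega>) \<rho>) > enat n}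
                    \<le> exp (- l * real n))))))
       \<and> (\<forall>t>0. (\<integral>\<^sup>+\<omega>. ennreal (exp (2 * t * real (the_enat (max_degree V E)) ^ R \<omega>)) \<partial>N) < \<infinity> \<longrightarrow>
            (\<integral>\<^sup>+\<omega>. ennreal (psi V E t (R \<omega>)) \<partial>N) < \<infinity>)"
proof -
  interpret bounded_graph V E by unfold_locales fact+
  have law: "(\<integral>\<^sup>+\<omega>. f (R \<omega>) \<partial>N) = (\<integral>\<^sup>+r. f r \<partial>\<nu>)" for f :: "nat \<Rightarrow> ennreal"
    using nn_integral_distr[OF R, of f] law_R by simp
  show ?thesis
    unfolding law[of "\<lambda>r. ennreal (phi V E r)"] law[of "\<lambda>r. ennreal (psi V E _ r)"] \<Delta>_def[symmetric]
    using exponential_rate[OF support root, where ?'w = 'w] psi_finite[OF _ _ R]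
    unfolding law[of "\<lambda>r. ennreal (psi V E _ r)"] by blast
qed

end
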